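(* Let $\Gamma$ be a countably infinite (discrete) group. Every tame continuous action $\Gamma\curvearrowright X$ on a compact metrizable space $X$ has zero naive topological entropy: $h^{\rm nv}(\Gamma\curvearrowright X)=0$.
   Context: Tameness: let $C(X)$ be the space of continuous $\mathbb R$-valued functions on $X$ with the supremum norm, with $\Gamma$ acting by $(sf)(x)=f(s^{-1}x)$. The action $\Gamma\curvearrowright X$ is untame if there are some $f\in C(X)$ and some infinite subset $H$ of $\Gamma$ such that the map $\delta_s\mapsto sf$ for $s\in H$ extends to a linear Banach space isomorphism (not necessarily isometric) from $\ell^1(H)$ onto the closed linear span of $\{sf: s\in H\}$ in $C(X)$; here $\delta_s$ is the canonical basis vector of $\ell^1(H)$ at $s$. The action is tame if it is not untame. Naive topological entropy: for a finite open cover $\mathcal U$ of $X$, $N(\mathcal U)$ is the minimal cardinality of subcovers of $\mathcal U$. For covers $\mathcal U,\mathcal V$, $\mathcal U\vee\mathcal V=\{U\cap V: U\in\mathcal U, V\in\mathcal V\}$. For a nonempty finite $F\subseteq\Gamma$, $\mathcal U^F=\bigvee_{s\in F}s^{-1}\mathcal U$. Set $h^{\rm nv}(\Gamma,\mathcal U)=\inf_F\frac{1}{|F|}\log N(\mathcal U^F)$, with $F$ ranging over nonempty finite subsets of $\Gamma$, and $h^{\rm nv}(\Gamma\curvearrowright X)=\sup_{\mathcal U}h^{\rm nv}(\Gamma,\mathcal U)$, with $\mathcal U$ ranging over finite open covers of $X$. *)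

theory Defs
  imports "HOL-Analysis.Analysis" "HOL-Algebra.Group_Action"
begin

text \<open>
  The space \<open>X\<close> is the carrier of a type (hence nonempty), and \<open>C(X)\<close> is the Banach space
  \<^typ>\<open>'x \<Rightarrow>\<^sub>C real\<close>, since continuous functions on a compact space are bounded.
  As the group is discrete, continuity of the action means that every group element acts by a
  continuous map.
\<close>

definition continuous_action ::
    "('g, 'm) monoid_scheme \<Rightarrow> ('g \<Rightarrow> 'x::topological_space \<Rightarrow> 'x) \<Rightarrow> bool" where
  "continuous_action G \<alpha> \<longleftrightarrow>
     group_action G UNIV \<alpha> \<and> (\<forall>s\<in>carrier G. continuous_on UNIV (\<alpha> s))"


section \<open>Tameness\<close>

definition translate ::
    "('g, 'm) monoid_scheme \<Rightarrow> ('g \<Rightarrow> 'x::topological_space \<Rightarrow> 'x) \<Rightarrow> 'g \<Rightarrow> ('x \<Rightarrow>\<^sub>C real) \<Rightarrow> ('x \<Rightarrow>\<^sub>C real)"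
  where
  "translate G \<alpha> s f = Bcontfun (\<lambda>x. apply_bcontfun f (\<alpha> (inv\<^bsub>G\<^esub> s) x))"

lemma apply_translate:
  assumes "continuous_action G \<alpha>" "s \<in> carrier G"
  shows "apply_bcontfun (translate G \<alpha> s f) x = apply_bcontfun f (\<alpha> (inv\<^bsub>G\<^esub> s) x)"
proof -
  interpret group_action G UNIV \<alpha>
    using assms(1) by (simp add: continuous_action_def)
  interpret group_hom G "BijGroup UNIV" \<alpha>
    by (rule group_hom)
  have "inv\<^bsub>G\<^esub> s \<in> carrier G"
    using assms(2) by simp
  then have "continuous_on UNIV (\<alpha> (inv\<^bsub>G\<^esub> s))"
    using assms(1) by (simp add: continuous_action_def)
  then have "continuous_on UNIV (\<lambda>x. apply_bcontfun f (\<alpha> (inv\<^bsub>G\<^esub> s) x))"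
    by (rule continuous_on_compose2[OF continuous_on_apply_bcontfun[of UNIV]]) simp
  moreover have "bounded (range (\<lambda>x. apply_bcontfun f (\<alpha> (inv\<^bsub>G\<^esub> s) x)))"
    by (rule bounded_subset[OF bounded_apply_bcontfun[of f]]) auto
  ultimately show ?thesis
    by (simp add: translate_def bcontfun_def Bcontfun_inverse)
qed

text \<open>Elements of \<open>\<ell>\<^sup>1(H)\<close> are represented by their extension by zero outside \<open>H\<close>.\<close>

definition ell1 :: "'g set \<Rightarrow> ('g \<Rightarrow> real) set" where
  "ell1 H = {a. (\<forall>s. s \<notin> H \<longrightarrow> a s = 0) \<and> (\<lambda>s. \<bar>a s\<bar>) summable_on H}"

definition ell1_norm :: "'g set \<Rightarrow> ('g \<Rightarrow> real) \<Rightarrow> real" where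
  "ell1_norm H a = (\<Sum>\<^sub>\<infinity>s\<in>H. \<bar>a s\<bar>)"

definition delta :: "'g \<Rightarrow> 'g \<Rightarrow> real" where
  "delta s = (\<lambda>t. if t = s then 1 else 0)"

text \<open>
  An isomorphism is a linear bijection \<open>T\<close> that is bounded and has a bounded inverse; the last
  condition is the lower bound on \<open>T\<close>.
\<close>

definition ell1_isomorphism ::
    "'g set \<Rightarrow> 'b::real_normed_vector set \<Rightarrow> (('g \<Rightarrow> real) \<Rightarrow> 'b) \<Rightarrow> bool" where
  "ell1_isomorphism H V T \<longleftrightarrow>
     (\<forall>a\<in>ell1 H. \<forall>b\<in>ell1 H. T (\<lambda>s. a s + b s) = T a + T b) \<and>
     (\<forall>c. \<forall>a\<in>ell1 H. T (\<lambda>s. c * a s) = c *\<^sub>R T a) \<and>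
     bij_betw T (ell1 H) V \<and>
     (\<exists>C. \<forall>a\<in>ell1 H. norm (T a) \<le> C * ell1_norm H a) \<and>
     (\<exists>C. \<forall>a\<in>ell1 H. ell1_norm H a \<le> C * norm (T a))"

definition untame ::
    "('g, 'm) monoid_scheme \<Rightarrow> ('g \<Rightarrow> 'x::topological_space \<Rightarrow> 'x) \<Rightarrow> bool" where
  "untame G \<alpha> \<longleftrightarrow>
     (\<exists>f :: 'x \<Rightarrow>\<^sub>C real. \<exists>H. H \<subseteq> carrier G \<and> infinite H \<and>
        (\<exists>T. ell1_isomorphism H (closure (span ((\<lambda>s. translate G \<alpha> s f) ` H))) T \<and>
             (\<forall>s\<in>H. T (delta s) = translate G \<alpha> s f)))"

definition tame ::
    "('g, 'm) monoid_scheme \<Rightarrow> ('g \<Rightarrow> 'x::topological_space \<Rightarrow> 'x) \<Rightarrow> bool" where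
  "tame G \<alpha> \<longleftrightarrow> \<not> untame G \<alpha>"


section \<open>Naive topological entropy\<close>

definition finite_open_cover :: "'x::topological_space set set \<Rightarrow> bool" where
  "finite_open_cover \<U> \<longleftrightarrow> finite \<U> \<and> (\<forall>U\<in>\<U>. open U) \<and> \<Union>\<U> = UNIV"

definition cover_number :: "'x set set \<Rightarrow> nat" where
  "cover_number \<U> = (LEAST n. \<exists>\<V>\<subseteq>\<U>. finite \<V> \<and> \<Union>\<V> = UNIV \<and> card \<V> = n)"

definition cover_join :: "'x set set \<Rightarrow> 'x set set \<Rightarrow> 'x set set" where
  "cover_join \<U> \<V> = {U \<inter> V |U V. U \<in> \<U> \<and> V \<in> \<V>}"

definition join_translates ::
    "('g, 'm) monoid_scheme \<Rightarrow> ('g \<Rightarrow> 'x \<Rightarrow> 'x) \<Rightarrow> 'x set set \<Rightarrow> 'g set \<Rightarrow> 'x set set" where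
  "join_translates G \<alpha> \<U> F =
     Finite_Set.fold (\<lambda>s. cover_join ((\<lambda>U. \<alpha> (inv\<^bsub>G\<^esub> s) ` U) ` \<U>)) {UNIV} F"

text \<open>
  The operation \<^const>\<open>cover_join\<close> is associative and commutative with unit \<open>{UNIV}\<close>, so the
  fold does not depend on an order of \<open>F\<close>.
\<close>

lemma cover_join_unit: "cover_join \<U> {UNIV} = \<U>"
  by (auto simp: cover_join_def)

lemma join_translates_empty: "join_translates G \<alpha> \<U> {} = {UNIV}"
  by (simp add: join_translates_def)

lemma join_translates_insert:
  assumes "finite F" "s \<notin> F"
  shows "join_translates G \<alpha> \<U> (insert s F) =
    cover_join ((\<lambda>U. \<alpha> (inv\<^bsub>G\<^esub> s) ` U) ` \<U>) (join_translates G \<alpha> \<U> F)"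
proof -
  have *: "cover_join \<A> (cover_join \<B> \<C>) = cover_join \<B> (cover_join \<A> \<C>)"
    for \<A> \<B> \<C> :: "'b set set"
    unfolding cover_join_def by (auto, (metis Int_left_commute)+)
  interpret comp_fun_commute "\<lambda>s. cover_join ((\<lambda>U. \<alpha> (inv\<^bsub>G\<^esub> s) ` U) ` \<U>)"
    by standard (rule ext, simp add: *)
  show ?thesis
    unfolding join_translates_def using assms by (rule fold_insert)
qed

text \<open>Both infimum and supremum are taken in \<^typ>\<open>ereal\<close>, as the entropy may be infinite.\<close>

definition naive_entropy_cover ::
    "('g, 'm) monoid_scheme \<Rightarrow> ('g \<Rightarrow> 'x \<Rightarrow> 'x) \<Rightarrow> 'x set set \<Rightarrow> ereal" where
  "naive_entropy_cover G \<alpha> \<U> =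
     (INF F\<in>{F. F \<subseteq> carrier G \<and> finite F \<and> F \<noteq> {}}.
        ereal (1 / real (card F) * ln (real (cover_number (join_translates G \<alpha> \<U> F)))))"

definition naive_entropy ::
    "('g, 'm) monoid_scheme \<Rightarrow> ('g \<Rightarrow> 'x::topological_space \<Rightarrow> 'x) \<Rightarrow> ereal" where
  "naive_entropy G \<alpha> = (SUP \<U>\<in>{\<U>. finite_open_cover \<U>}. naive_entropy_cover G \<alpha> \<U>)"

end

theory Submission
  imports Defs
begin

text \<open>
  Suppose that some finite open cover \<open>\<U>\<close> has positive naive entropy, and shrink it to a closed
  cover by sets \<open>D U \<subseteq> U\<close>. A Sauer--Shelah type induction turns exponential growth of the cover
  numbers into independence: there is \<open>c > 0\<close> such that every finite \<open>F\<close> contains, for some \<open>U\<close>,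
  an independence set for the pair \<open>(D U, - U)\<close> of size at least \<open>c * card F\<close>. The independence
  sets form a hereditary family that is invariant under right translations. In the absence of
  amenability the pigeonhole principle cannot be used to fix one finite configuration that recurs
  with positive density in every finite set. Instead, one keeps finitely many candidate
  configurations, and lets the choice depend on the point; these can be enlarged one element at a
  time, and Koenig's lemma yields an infinite set all of whose finite subsets are independence sets.
  An Urysohn function separating \<open>D U\<close> from \<open>- U\<close> then has translates that span \<open>\<ell>\<^sup>1\<close> isometrically.
\<close>

section \<open>A Sauer--Shelah lemma for partially defined patterns\<close>

text \<open>For \<open>A s i\<close> the preimage of \<open>B i\<close> under \<open>s\<close>, this
  is independence of the pair \<open>(B True, B False)\<close> along \<open>J\<close>. The empty set
  is shattered exactly when \<open>Y\<close> is nonempty.\<close>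

definition shattered :: "('z \<Rightarrow> bool \<Rightarrow> 'x set) \<Rightarrow> 'x set \<Rightarrow> 'z set \<Rightarrow> bool" where
  "shattered A Y J \<longleftrightarrow> (\<forall>\<omega>. \<exists>y\<in>Y. \<forall>z\<in>J. y \<in> A z (\<omega> z))"

text \<open>
  A point \<open>y\<close> has the value \<open>i\<close> at \<open>z\<close> if \<open>y \<in> A z i\<close>, and this may be undefined. In \<open>avoided\<close>, the
  function \<open>\<omega>\<close> stands for the set of points that lie outside \<open>A z (\<omega> z)\<close> for all \<open>z\<close>, a member of the
  join of the covers \<open>{- A z True, - A z False}\<close>.
\<close>

definition avoided :: "('z \<Rightarrow> bool \<Rightarrow> 'x set) \<Rightarrow> 'x set \<Rightarrow> 'z set \<Rightarrow> ('z \<Rightarrow> bool) set \<Rightarrow> bool" where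
  "avoided A Y Z \<Omega> \<longleftrightarrow> (\<forall>y\<in>Y. \<exists>\<omega>\<in>\<Omega>. \<forall>z\<in>Z. y \<notin> A z (\<omega> z))"

lemma shatteredE:
  assumes "shattered A Y J"
  obtains y where "y \<in> Y" "\<And>z. z \<in> J \<Longrightarrow> y \<in> A z (\<omega> z)"
  using assms unfolding shattered_def by blast

lemma shattered_mono: "shattered A Y J \<Longrightarrow> Y \<subseteq> Y' \<Longrightarrow> shattered A Y' J"
  unfolding shattered_def by (meson subset_iff)

text \<open>A set shattered by either half is shattered by \<open>Y\<close>. One shattered by both
  halves counts twice on the left and yields a second set on the right, since \<open>z\<close> can
  then be added to it.\<close>

lemma card_shattered_insert:
  assumes "finite Z" "z \<notin> Z"
  shows "card {J. J \<subseteq> Z \<and> shattered A (Y \<inter> A z True) J} + card {J. J \<subseteq> Z \<and> shattered A (Y \<inter> A z False) J}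
    \<le> card {J. J \<subseteq> insert z Z \<and> shattered A Y J}" (is "card ?P + card ?N \<le> card ?S")
proof -
  have fin: "finite ?P" "finite ?N" "finite ?S"
    using assms(1) by (auto intro: finite_subset[of _ "Pow (insert z Z)"])
  have "shattered A Y (insert z J)" if "J \<in> ?P \<inter> ?N" for J
    unfolding shattered_def
  proof
    fix \<omega>
    have "shattered A (Y \<inter> A z (\<omega> z)) J"
      using that by (cases "\<omega> z") auto
    then show "\<exists>y\<in>Y. \<forall>w\<in>insert z J. y \<in> A w (\<omega> w)"
      unfolding shattered_def by fastforce
  qed
  then have sub: "(?P \<union> ?N) \<union> insert z ` (?P \<inter> ?N) \<subseteq> ?S"
    by (auto elim!: shattered_mono)
  have "card ?P + card ?N = card (?P \<union> ?N) + card (?P \<inter> ?N)"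
    using fin(1,2) by (rule card_Un_Int)
  also have "card (?P \<inter> ?N) = card (insert z ` (?P \<inter> ?N))"
    using assms(2) by (intro card_image[symmetric] inj_onI) (auto simp: insert_ident)
  also have "card (?P \<union> ?N) + \<dots> = card ((?P \<union> ?N) \<union> insert z ` (?P \<inter> ?N))"
    using assms(2) fin by (intro card_Un_disjoint[symmetric]) auto
  also have "\<dots> \<le> card ?S"
    using sub fin by (intro card_mono)
  finally show ?thesis .
qed

text \<open>
  One of the sets \<open>Y \<inter> A z i\<close> shatters at most half as many sets as \<open>Y\<close>. Covering it separately costs
  a factor \<open>1 + 1 / 2 ^ p\<close>, and on the rest of \<open>Y\<close> the coordinate \<open>z\<close> is harmless.
\<close>

lemma avoided_card_le_shattered:
  fixes A :: "'z \<Rightarrow> bool \<Rightarrow> 'x set"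
  assumes "finite Z" and disj: "\<And>z. A z True \<inter> A z False = {}" and "p \<noteq> 0"
  shows "\<exists>\<Omega>. finite \<Omega> \<and> avoided A Y Z \<Omega> \<and>
    real (card \<Omega>) \<le> real (card {J. J \<subseteq> Z \<and> shattered A Y J}) ^ p * (1 + 1 / 2 ^ p) ^ card Z"
  using assms(1)
proof (induction Z arbitrary: Y)
  case empty
  show ?case
  \<comment> \<open>The empty \<open>Y\<close> shatters nothing, so the bound is 0 and forces the
    empty family.\<close>
  proof (cases "Y = {}")
    case True
    then show ?thesis
      by (intro exI[of _ "{}"]) (auto simp: avoided_def shattered_def)
  next
    case False
    then have "{J. J \<subseteq> {} \<and> shattered A Y J} = {{}}"
      by (auto simp: shattered_def)
    then show ?thesis
      by (intro exI[of _ "{\<lambda>_. True}"]) (auto simp: avoided_def)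
  qed
next
  case (insert z Z)
  define sh where "sh Y = card {J. J \<subseteq> Z \<and> shattered A Y J}" for Y
  define w where "w = card {J. J \<subseteq> insert z Z \<and> shattered A Y J}"
  let ?\<kappa> = "1 + 1 / 2 ^ p :: real"
  have fin: "finite {J. J \<subseteq> insert z Z \<and> shattered A Y J}"
    using insert.hyps(1) by (auto intro: finite_subset[of _ "Pow (insert z Z)"])
  have "sh (Y \<inter> A z True) + sh (Y \<inter> A z False) \<le> w"
    unfolding sh_def w_def using insert.hyps by (rule card_shattered_insert)
  then have "2 * sh (Y \<inter> A z True) \<le> w \<or> 2 * sh (Y \<inter> A z False) \<le> w"
    by linarith
  then obtain i where i: "2 * sh (Y \<inter> A z i) \<le> w"
    by blast
  have rest: "sh (Y - A z i) \<le> w"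
    unfolding sh_def w_def using fin by (intro card_mono) (auto elim!: shattered_mono)
  obtain \<Omega>1 where \<Omega>1: "finite \<Omega>1" "avoided A (Y \<inter> A z i) Z \<Omega>1"
      "real (card \<Omega>1) \<le> real (sh (Y \<inter> A z i)) ^ p * ?\<kappa> ^ card Z"
    using insert.IH unfolding sh_def by blast
  obtain \<Omega>2 where \<Omega>2: "finite \<Omega>2" "avoided A (Y - A z i) Z \<Omega>2"
      "real (card \<Omega>2) \<le> real (sh (Y - A z i)) ^ p * ?\<kappa> ^ card Z"
    using insert.IH unfolding sh_def by blast
  \<comment> \<open>Points of \<open>A z i\<close> avoid \<open>A z (\<not> i)\<close> by
    disjointness, and all other points avoid \<open>A z i\<close>; this dictates the values at
    \<open>z\<close>.\<close>
  define \<Omega> where "\<Omega> = (\<lambda>\<omega>. fun_upd \<omega> z (\<not> i)) ` \<Omega>1 \<union> (\<lambda>\<omega>. fun_upd \<omega> z i) ` \<Omega>2"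
  have "avoided A Y (insert z Z) \<Omega>"
    unfolding avoided_def
  proof
    fix y assume y: "y \<in> Y"
    show "\<exists>\<omega>\<in>\<Omega>. \<forall>v\<in>insert z Z. y \<notin> A v (\<omega> v)"
    proof (cases "y \<in> A z i")
      case True
      then obtain \<omega> where "\<omega> \<in> \<Omega>1" "\<forall>v\<in>Z. y \<notin> A v (\<omega> v)"
        using \<Omega>1(2) y unfolding avoided_def by blast
      moreover have "y \<notin> A z (\<not> i)"
        using True disj[of z] by (cases i) auto
      ultimately show ?thesis
        using insert.hyps(2) unfolding \<Omega>_def by (intro bexI[of _ "fun_upd \<omega> z (\<not> i)"]) auto
    next
      case False
      then obtain \<omega> where "\<omega> \<in> \<Omega>2" "\<forall>v\<in>Z. y \<notin> A v (\<omega> v)"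
        using \<Omega>2(2) y unfolding avoided_def by blast
      then show ?thesis
        using False insert.hyps(2) unfolding \<Omega>_def by (intro bexI[of _ "fun_upd \<omega> z i"]) auto
    qed
  qed
  moreover have "real (card \<Omega>) \<le> real w ^ p * ?\<kappa> ^ card (insert z Z)"
  proof -
    have "card \<Omega> \<le> card \<Omega>1 + card \<Omega>2"
      unfolding \<Omega>_def using \<Omega>1(1) \<Omega>2(1)
      by (meson add_mono card_Un_le card_image_le le_trans)
    then have "real (card \<Omega>) \<le> real (sh (Y \<inter> A z i)) ^ p * ?\<kappa> ^ card Z + real (sh (Y - A z i)) ^ p * ?\<kappa> ^ card Z"
      using \<Omega>1(3) \<Omega>2(3) by linarith
    also have "\<dots> \<le> (real w / 2) ^ p * ?\<kappa> ^ card Z + real w ^ p * ?\<kappa> ^ card Z"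
      using i rest by (intro add_mono mult_right_mono power_mono) auto
    also have "\<dots> = real w ^ p * ?\<kappa> ^ card (insert z Z)"
      using insert.hyps by (simp add: power_divide field_simps)
    finally show ?thesis .
  qed
  moreover have "finite \<Omega>"
    unfolding \<Omega>_def using \<Omega>1(1) \<Omega>2(1) by auto
  ultimately show ?case
    unfolding w_def by blast
qed

section \<open>From exponential growth to shattered sets of linear size\<close>

text \<open>A Chernoff type estimate: give \<open>J\<close> the weight \<open>x ^ card J\<close>. As
  \<open>x \<le> 1\<close>, every \<open>J\<close> that is counted has weight at least
  \<open>x powr t\<close>, while the weights of all subsets add up to
  \<open>(1 + x) ^ card Z\<close>.\<close>

lemma card_small_subsets_le:
  fixes x t :: real
  assumes "finite Z" "0 < x" "x \<le> 1"
  shows "real (card {J. J \<subseteq> Z \<and> real (card J) \<le> t}) \<le> (1 + x) ^ card Z * x powr (- t)"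
proof -
  have "real (card {J. J \<subseteq> Z \<and> real (card J) \<le> t}) = (\<Sum>J | J \<subseteq> Z \<and> real (card J) \<le> t. 1)"
    by simp
  also have "\<dots> \<le> (\<Sum>J | J \<subseteq> Z \<and> real (card J) \<le> t. x ^ card J * x powr (- t))"
  proof (rule sum_mono)
    fix J assume "J \<in> {J. J \<subseteq> Z \<and> real (card J) \<le> t}"
    then have "x powr 0 \<le> x powr (real (card J) - t)"
      using assms by (intro powr_mono') auto
    then show "1 \<le> x ^ card J * x powr (- t)"
      using assms by (simp add: powr_diff powr_realpow powr_minus field_simps)
  qed
  also have "\<dots> \<le> (\<Sum>J\<in>Pow Z. x ^ card J * x powr (- t))"
    using assms by (intro sum_mono2) auto
  also have "\<dots> = (\<Sum>J\<in>Pow Z. \<Prod>j\<in>J. x) * x powr (- t)"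
    by (simp add: sum_distrib_right)
  also have "(\<Sum>J\<in>Pow Z. \<Prod>j\<in>J. x) = (\<Prod>j\<in>Z. x + 1)"
    using assms by (subst prod_add) auto
  finally show ?thesis
    by (simp add: add.commute)
qed

text \<open>If all shattered sets had fewer than \<open>c * card Z\<close> elements, their number
  would grow at a small exponential rate, and \<open>avoided_card_le_shattered\<close> would produce
  an \<open>\<Omega>\<close> that is too small. The constant \<open>c\<close> depends on
  \<open>b\<close> only.\<close>

lemma avoided_exp_imp_large_shattered:
  fixes b :: real
  assumes "b > 0"
  obtains c :: real where "c > 0"
    "\<And>(A :: 'z \<Rightarrow> bool \<Rightarrow> 'x set) Y Z. finite Z \<Longrightarrow> Z \<noteq> {} \<Longrightarrow> (\<And>z. A z True \<inter> A z False = {}) \<Longrightarrow>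
       (\<And>\<Omega>. finite \<Omega> \<Longrightarrow> avoided A Y Z \<Omega> \<Longrightarrow> exp (b * real (card Z)) \<le> real (card \<Omega>)) \<Longrightarrow>
       \<exists>J\<subseteq>Z. shattered A Y J \<and> c * real (card Z) \<le> real (card J)"
proof -
  obtain p :: nat where p: "(1/2) ^ p < b / 2"
    using real_arch_pow_inv[of "b/2" "1/2"] assms by auto
  define q where "q = Suc p"
  have q: "1 / 2 ^ q < b / 2"
    using p unfolding q_def by (simp add: power_divide field_simps)
  \<comment> \<open>The numbers \<open>x\<close> and \<open>c\<close> each contribute at most
    \<open>b / 8\<close> to the rate of \<open>real (card S) ^ q\<close>, and
    \<open>(1 + 1 / 2 ^ q) ^ n\<close> adds at most \<open>b / 2\<close>; the total
    \<open>3/4 * b\<close> stays below \<open>b\<close>. The denominator of \<open>c\<close> has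
    \<open>1 - ln x\<close> because \<open>ln x\<close> vanishes for \<open>x = 1\<close>.\<close>
  define x where "x = min 1 (b / (8 * real q))"
  have qpos: "real q > 0" by (simp add: q_def)
  have x: "0 < x" "x \<le> 1" "real q * x \<le> b / 8"
    using assms qpos by (auto simp: x_def min_def field_simps)
  define c where "c = b / (8 * real q * (1 - ln x))"
  have lnx: "ln x \<le> 0" using x by simp
  have c: "c > 0" "real q * (c * (- ln x)) \<le> b / 8"
  proof -
    show "c > 0"
      using assms qpos lnx by (auto simp: c_def intro!: divide_pos_pos mult_pos_pos)
    have "real q * (c * (- ln x)) = (b / 8) * ((- ln x) / (1 - ln x))"
      using qpos lnx by (simp add: c_def divide_simps)
    also have "\<dots> \<le> (b / 8) * 1"
      using assms lnx by (intro mult_left_mono) (auto simp: divide_simps)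
    finally show "real q * (c * (- ln x)) \<le> b / 8" by simp
  qed
  show thesis
  proof (rule that[OF c(1)])
    fix A :: "'z \<Rightarrow> bool \<Rightarrow> 'x set" and Y Z
    assume fin: "finite Z" and ne: "Z \<noteq> {}" and disj: "\<And>z. A z True \<inter> A z False = {}"
      and large: "\<And>\<Omega>. finite \<Omega> \<Longrightarrow> avoided A Y Z \<Omega> \<Longrightarrow> exp (b * real (card Z)) \<le> real (card \<Omega>)"
    define n where "n = card Z"
    have n: "real n > 0" using fin ne by (simp add: n_def card_gt_0_iff)
    define S where "S = {J. J \<subseteq> Z \<and> shattered A Y J}"
    obtain \<Omega> where \<Omega>: "finite \<Omega>" "avoided A Y Z \<Omega>" "real (card \<Omega>) \<le> real (card S) ^ q * (1 + 1 / 2 ^ q) ^ n"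
      using avoided_card_le_shattered[where A = A and Y = Y and p = q, OF fin disj]
      unfolding S_def q_def n_def by blast
    show "\<exists>J\<subseteq>Z. shattered A Y J \<and> c * real (card Z) \<le> real (card J)"
    proof (rule ccontr)
      assume neg: "\<not> ?thesis"
      have "real (card S) \<le> real (card {J. J \<subseteq> Z \<and> real (card J) \<le> c * real n})"
        using neg fin by (intro of_nat_mono card_mono) (auto simp: S_def n_def not_le intro: less_imp_le)
      also have "\<dots> \<le> (1 + x) ^ n * x powr (- (c * real n))"
        unfolding n_def using fin x by (intro card_small_subsets_le)
      also have "\<dots> \<le> exp x ^ n * exp (c * (- ln x) * real n)"
        using x by (intro mult_mono power_mono) (auto simp: powr_def)
      also have "\<dots> = exp ((x + c * (- ln x)) * real n)"
        by (simp add: exp_of_nat_mult[symmetric] exp_add[symmetric] algebra_simps)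
      finally have "real (card S) ^ q \<le> exp ((x + c * (- ln x)) * real n) ^ q"
        by (intro power_mono) auto
      also have "\<dots> = exp (real q * ((x + c * (- ln x)) * real n))"
        by (simp add: exp_of_nat_mult[symmetric])
      also have "\<dots> \<le> exp (b / 4 * real n)"
        using mult_right_mono[OF add_mono[OF x(3) c(2)], of "real n"] n by (simp add: algebra_simps)
      finally have 1: "real (card S) ^ q \<le> exp (b / 4 * real n)" .
      have "(1 + 1 / 2 ^ q) ^ n \<le> exp (1 / 2 ^ q :: real) ^ n"
        by (intro power_mono) (auto intro: add_nonneg_nonneg)
      also have "\<dots> = exp (real n * (1 / 2 ^ q))"
        by (rule exp_of_nat_mult[symmetric])
      also have "\<dots> \<le> exp (b / 2 * real n)"
        using mult_right_mono[OF less_imp_le[OF q], of "real n"] n by (simp add: mult.commute)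
      finally have 2: "(1 + 1 / 2 ^ q :: real) ^ n \<le> exp (b / 2 * real n)" .
      have "exp (b * real n) \<le> real (card S) ^ q * (1 + 1 / 2 ^ q) ^ n"
        using large[OF \<Omega>(1,2)] \<Omega>(3) unfolding n_def by linarith
      also have "\<dots> \<le> exp (b / 4 * real n) * exp (b / 2 * real n)"
        using 1 2 by (intro mult_mono) auto
      also have "\<dots> = exp (3/4 * b * real n)"
        by (simp add: exp_add[symmetric] algebra_simps)
      also have "\<dots> < exp (b * real n)"
        using assms n by simp
      finally show False by simp
    qed
  qed
qed

section \<open>Infinite sets from translation invariant families of positive density\<close>

text \<open>Greedy choice: keep a point \<open>s\<close> and discard \<open>s\<close>, all
  \<open>d \<otimes> s\<close> and all \<open>inv d \<otimes> s\<close>, at most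
  \<open>Suc (2 * card D)\<close> points. The inverses take care of the pairs in which
  \<open>s\<close> comes second.\<close>

lemma (in group) separated_subset:
  assumes "finite K" "K \<subseteq> carrier G" "finite D" "D \<subseteq> carrier G"
  shows "\<exists>K'\<subseteq>K. card K \<le> Suc (2 * card D) * card K' \<and>
    (\<forall>s\<in>K'. \<forall>t\<in>K'. s \<noteq> t \<longrightarrow> (\<forall>d\<in>D. t \<noteq> d \<otimes> s))"
  using assms(1,2)
proof (induction K rule: finite_psubset_induct)
  case (psubset K)
  show ?case
  proof (cases "K = {}")
    case True
    then show ?thesis by auto
  next
    case False
    then obtain s where s: "s \<in> K" by auto
    have sG: "s \<in> carrier G" using s psubset.prems by auto
    define N where "N = insert s ((\<lambda>d. d \<otimes> s) ` D \<union> (\<lambda>d. inv d \<otimes> s) ` D)"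
    have "card N \<le> Suc (card ((\<lambda>d. d \<otimes> s) ` D \<union> (\<lambda>d. inv d \<otimes> s) ` D))"
      unfolding N_def by (rule card_insert_le_m1) auto
    also have "card ((\<lambda>d. d \<otimes> s) ` D \<union> (\<lambda>d. inv d \<otimes> s) ` D) \<le> card D + card D"
      using assms(3) by (intro order_trans[OF card_Un_le] add_mono card_image_le)
    finally have N: "card N \<le> Suc (2 * card D)" by simp
    have "K - N \<subset> K" using s unfolding N_def by auto
    moreover have "K - N \<subseteq> carrier G" using psubset.prems by auto
    ultimately have "\<exists>K'\<subseteq>K - N. card (K - N) \<le> Suc (2 * card D) * card K' \<and>
        (\<forall>s\<in>K'. \<forall>t\<in>K'. s \<noteq> t \<longrightarrow> (\<forall>d\<in>D. t \<noteq> d \<otimes> s))"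
      by (rule psubset.IH)
    then obtain K' where K': "K' \<subseteq> K - N" "card (K - N) \<le> Suc (2 * card D) * card K'"
        "\<forall>s\<in>K'. \<forall>t\<in>K'. s \<noteq> t \<longrightarrow> (\<forall>d\<in>D. t \<noteq> d \<otimes> s)"
      by (elim exE conjE) (rule that)
    have "s \<notin> K'" using K'(1) unfolding N_def by auto
    moreover have "finite K'" using K'(1) psubset.hyps by (meson finite_Diff finite_subset)
    ultimately have card: "card (insert s K') = Suc (card K')" by simp
    have "finite N" unfolding N_def using assms(3) by simp
    then have "card K \<le> card ((K - N) \<union> N)"
      using psubset.hyps by (intro card_mono) auto
    also have "\<dots> \<le> card (K - N) + card N"
      by (rule card_Un_le)
    also have "\<dots> \<le> Suc (2 * card D) * card (insert s K')"
      unfolding card using K'(2) N by (simp add: algebra_simps)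
    finally have "card K \<le> Suc (2 * card D) * card (insert s K')" .
    moreover have "s \<noteq> d \<otimes> t" if t: "t \<in> K'" and d: "d \<in> D" for t d
    proof
      assume "s = d \<otimes> t"
      moreover have "t \<in> carrier G" "d \<in> carrier G"
        using t d K'(1) psubset.prems assms(4) by auto
      ultimately have "t = inv d \<otimes> s"
        by (simp add: m_assoc[symmetric])
      then show False using d t K'(1) unfolding N_def by auto
    qed
    moreover have "t \<noteq> d \<otimes> s" if "t \<in> K'" "d \<in> D" for t d
      using that K'(1) unfolding N_def by auto
    ultimately show ?thesis
      using K'(1,3) s by (intro exI[of _ "insert s K'"]) auto
  qed
qed

text \<open>
  The list \<open>E s\<close> is the candidate configuration chosen at the point \<open>s\<close>, translated so that the unit
  goes to \<open>b s \<otimes> s\<close>. Configurations are lists with the newest element first, so that \<^const>\<open>tl\<close>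
  recovers the configuration that was extended.
\<close>

definition pattern_copy ::
    "('g, 'm) monoid_scheme \<Rightarrow> 'g set set \<Rightarrow> 'g list set \<Rightarrow> 'g set \<Rightarrow> 'g set \<Rightarrow> bool" where
  "pattern_copy G \<I> \<E> B S \<longleftrightarrow> (\<exists>b\<in>S \<rightarrow> B. \<exists>E\<in>S \<rightarrow> \<E>.
     (\<Union>s\<in>S. (\<lambda>x. x \<otimes>\<^bsub>G\<^esub> (b s \<otimes>\<^bsub>G\<^esub> s)) ` set (E s)) \<in> \<I>)"

text \<open>\<open>B\<close> and \<open>c\<close> are uniform in \<open>K\<close>. The density is
  that of the index set \<open>S\<close>; the factors from the finite set \<open>B\<close> allow
  base points to move by a bounded amount.\<close>

definition dense_patterns ::
    "('g, 'm) monoid_scheme \<Rightarrow> 'g set set \<Rightarrow> 'g list set \<Rightarrow> bool" where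
  "dense_patterns G \<I> \<E> \<longleftrightarrow> (\<exists>B c. finite B \<and> B \<subseteq> carrier G \<and> (0::real) < c \<and>
     (\<forall>K. finite K \<longrightarrow> K \<subseteq> carrier G \<longrightarrow>
       (\<exists>S\<subseteq>K. c * real (card K) \<le> real (card S) \<and> pattern_copy G \<I> \<E> B S)))"

text \<open>For \<open>K = {\<one>}\<close> positive density forces \<open>S = {\<one>}\<close>, so
  one right translate of a configuration lies in \<open>\<I>\<close>, and it can be translated
  back.\<close>

lemma (in group) dense_patterns_imp_member:
  assumes "dense_patterns G \<I> \<E>" and "\<And>xs. xs \<in> \<E> \<Longrightarrow> set xs \<subseteq> carrier G"
    and transl: "\<And>I t. I \<in> \<I> \<Longrightarrow> t \<in> carrier G \<Longrightarrow> (\<lambda>x. x \<otimes> t) ` I \<in> \<I>"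
  shows "\<exists>xs\<in>\<E>. set xs \<in> \<I>"
proof -
  obtain B c where B: "B \<subseteq> carrier G" "(0::real) < c"
    and K: "\<And>K. finite K \<Longrightarrow> K \<subseteq> carrier G \<Longrightarrow>
       \<exists>S\<subseteq>K. c * real (card K) \<le> real (card S) \<and> pattern_copy G \<I> \<E> B S"
    using assms(1) unfolding dense_patterns_def by blast
  obtain S where S: "S \<subseteq> {\<one>}" "c * real (card {\<one>}) \<le> real (card S)" "pattern_copy G \<I> \<E> B S"
    using K[of "{\<one>}"] by auto
  obtain b E where bE: "b \<in> S \<rightarrow> B" "E \<in> S \<rightarrow> \<E>" "(\<Union>s\<in>S. (\<lambda>x. x \<otimes> (b s \<otimes> s)) ` set (E s)) \<in> \<I>"
    using S(3) unfolding pattern_copy_def by (elim bexE) (rule that)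
  have [simp]: "S = {\<one>}" using S(1,2) B(2) by (cases "S = {}") auto
  have b: "b \<one> \<in> carrier G" and E: "E \<one> \<in> \<E>" using bE(1,2) B(1) by auto
  have "(\<lambda>x. x \<otimes> b \<one>) ` set (E \<one>) \<in> \<I>" using bE(3) b by simp
  then have "(\<lambda>x. x \<otimes> inv (b \<one>)) ` (\<lambda>x. x \<otimes> b \<one>) ` set (E \<one>) \<in> \<I>"
    using b by (intro transl[OF \<open>(\<lambda>x. x \<otimes> b \<one>) ` set (E \<one>) \<in> \<I>\<close>]) simp
  also have "(\<lambda>x. x \<otimes> inv (b \<one>)) ` (\<lambda>x. x \<otimes> b \<one>) ` set (E \<one>) = (\<lambda>x. x) ` set (E \<one>)"
    unfolding image_image using assms(2)[OF E] b by (intro image_cong) (auto simp: m_assoc subset_iff)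
  finally show ?thesis using E by auto
qed

lemma (in group) inv_mult_cancel_left:
  "a \<in> carrier G \<Longrightarrow> x \<in> carrier G \<Longrightarrow> inv a \<otimes> (a \<otimes> x) = x"
  by (simp flip: m_assoc)

text \<open>
  Take a finite set \<open>F\<close> with \<open>c * card F \<ge> 2\<close>. Many of the disjoint sets \<open>F s\<close> contain two points
  \<open>g s\<close> and \<open>g' s\<close> of the dense set, and the base point of the configuration at \<open>g' s\<close> is the new
  element of the one at \<open>g s\<close>. It really is new because \<open>F\<close> is sparse.
\<close>

lemma (in group) dense_patterns_extend:
  assumes inf: "infinite (carrier G)"
    and \<E>: "finite \<E>" "\<And>xs. xs \<in> \<E> \<Longrightarrow> set xs \<subseteq> carrier G" "\<And>xs. xs \<in> \<E> \<Longrightarrow> \<one> \<in> set xs"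
    and hered: "\<And>I J. I \<in> \<I> \<Longrightarrow> J \<subseteq> I \<Longrightarrow> J \<in> \<I>"
    and dense: "dense_patterns G \<I> \<E>"
  shows "\<exists>W. finite W \<and> W \<subseteq> carrier G \<and>
    dense_patterns G \<I> {w # xs |w xs. w \<in> W \<and> xs \<in> \<E> \<and> w \<notin> set xs}"
proof -
  obtain B c where B: "finite B" "B \<subseteq> carrier G" and c: "(0::real) < c"
    and BK: "\<And>K. finite K \<Longrightarrow> K \<subseteq> carrier G \<Longrightarrow>
       \<exists>S\<subseteq>K. c * real (card K) \<le> real (card S) \<and> pattern_copy G \<I> \<E> B S"
    using dense unfolding dense_patterns_def by blast
  \<comment> \<open>These are the left factors that would carry \<open>g s\<close> to
    \<open>g' s\<close> if the new element coincided with an old element \<open>x\<close>.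
    Separation of \<open>F\<close> by \<open>Q\<close> excludes this.\<close>
  define Q where "Q = (\<lambda>(b', x, b). inv b' \<otimes> x \<otimes> b) ` (B \<times> (\<Union>xs\<in>\<E>. set xs) \<times> B)"
  have Q: "finite Q" "Q \<subseteq> carrier G"
    unfolding Q_def using B \<E>(1,2) by (auto simp: subset_iff)
  obtain m :: nat where m: "2 / c \<le> real m" using real_arch_simple by blast
  obtain F0 where F0: "finite F0" "F0 \<subseteq> carrier G" "card F0 = Suc (2 * card Q) * Suc m"
    using inf by (metis infinite_arbitrarily_large)
  obtain F where F: "F \<subseteq> F0" "card F0 \<le> Suc (2 * card Q) * card F"
      "\<forall>s\<in>F. \<forall>t\<in>F. s \<noteq> t \<longrightarrow> (\<forall>q\<in>Q. t \<noteq> q \<otimes> s)"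
    using separated_subset[OF F0(1,2) Q] by (elim exE conjE) (rule that)
  have FG: "finite F" "F \<subseteq> carrier G" using F(1) F0 by (auto intro: finite_subset)
  have "Suc m \<le> card F" using F(2) unfolding F0(3) by (simp only: mult_le_cancel1)
  then have Fm: "2 \<le> c * real (card F)" "0 < card F"
    using m c by (auto simp: divide_simps mult.commute) (smt (verit) mult_left_mono of_nat_Suc of_nat_le_iff)
  \<comment> \<open>When \<open>K'\<close> is separated by \<open>D\<close>, the translates of
    \<open>F\<close> by points of \<open>K'\<close> are disjoint:
    \<open>f \<otimes> s = g \<otimes> t\<close> means
    \<open>t = (inv g \<otimes> f) \<otimes> s\<close>.\<close>
  define D where "D = (\<lambda>(f, g). inv f \<otimes> g) ` (F \<times> F)"
  have D: "finite D" "D \<subseteq> carrier G"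
    unfolding D_def using FG by auto
  define L where "L = Suc (2 * card D)"
  define W where "W = (\<lambda>(b', g', g, b). b' \<otimes> g' \<otimes> inv g \<otimes> inv b) ` (B \<times> F \<times> F \<times> B)"
  have W: "finite W" "W \<subseteq> carrier G"
    unfolding W_def using FG B by (auto simp: subset_iff)
  define B' where "B' = (\<lambda>(b, g). b \<otimes> g) ` (B \<times> F)"
  have B': "finite B'" "B' \<subseteq> carrier G"
    unfolding B'_def using FG B by (auto simp: subset_iff)
  define c' where "c' = 1 / (real L * real (card F))"
  have c': "c' > 0" using Fm by (simp add: c'_def L_def)
  define \<E>' where "\<E>' = {w # xs |w xs. w \<in> W \<and> xs \<in> \<E> \<and> w \<notin> set xs}"
  have "\<exists>S\<subseteq>K. c' * real (card K) \<le> real (card S) \<and> pattern_copy G \<I> \<E>' B' S"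
    if K: "finite K" "K \<subseteq> carrier G" for K
  proof -
    obtain K' where K': "K' \<subseteq> K" "card K \<le> L * card K'"
        "\<forall>s\<in>K'. \<forall>t\<in>K'. s \<noteq> t \<longrightarrow> (\<forall>d\<in>D. t \<noteq> d \<otimes> s)"
      using separated_subset[OF K D, folded L_def] by (elim exE conjE) (rule that)
    have K'G: "finite K'" "K' \<subseteq> carrier G" using K' K by (auto intro: finite_subset)
    have inj: "inj_on (\<lambda>(s, f). f \<otimes> s) (K' \<times> F)"
    proof (rule inj_onI, clarify)
      fix s f t g
      assume *: "s \<in> K'" "f \<in> F" "t \<in> K'" "g \<in> F" "f \<otimes> s = g \<otimes> t"
      then have G: "s \<in> carrier G" "t \<in> carrier G" "f \<in> carrier G" "g \<in> carrier G"
        using FG K'G by auto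
      have "s = t"
      proof (rule ccontr)
        assume "s \<noteq> t"
        have "t = inv g \<otimes> (f \<otimes> s)" using * G by (simp add: m_assoc[symmetric])
        then have "t = (inv g \<otimes> f) \<otimes> s" using G by (simp add: m_assoc)
        moreover have "inv g \<otimes> f \<in> D" unfolding D_def using * by auto
        ultimately show False using K'(3)[rule_format, OF *(1,3) \<open>s \<noteq> t\<close>] by blast
      qed
      then show "s = t \<and> f = g" using * G by simp
    qed
    define R where "R = (\<lambda>(s, f). f \<otimes> s) ` (K' \<times> F)"
    have R: "finite R" "R \<subseteq> carrier G" "card R = card K' * card F"
      unfolding R_def using FG K'G card_image[OF inj] by (auto simp: card_cartesian_product)
    obtain S where S: "S \<subseteq> R" "c * real (card R) \<le> real (card S)" "pattern_copy G \<I> \<E> B S"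
      using BK[OF R(1,2)] by blast
    obtain b E where bE: "b \<in> S \<rightarrow> B" "E \<in> S \<rightarrow> \<E>" "(\<Union>s\<in>S. (\<lambda>x. x \<otimes> (b s \<otimes> s)) ` set (E s)) \<in> \<I>"
      using S(3) unfolding pattern_copy_def by (elim bexE) (rule that)
    define r where "r s = {f \<in> F. f \<otimes> s \<in> S}" for s
    \<comment> \<open>Outside \<open>M\<close>, a translate of \<open>F\<close> meets
      \<open>S\<close> at most once, so \<open>card S\<close> is at most
      \<open>card K' + card M * card F\<close>. As it is at least \<open>2 * card K'\<close> by
      density, \<open>card M * card F\<close> is at least \<open>card K'\<close>.\<close>
    define M where "M = {s \<in> K'. 2 \<le> card (r s)}"
    have "S = (\<lambda>(s, f). f \<otimes> s) ` (SIGMA s:K'. r s)"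
      using S(1) unfolding R_def r_def by auto
    then have "card S = card (SIGMA s:K'. r s)"
      by (metis (no_types, lifting) card_image inj inj_on_subset Sigma_mono r_def mem_Collect_eq subset_iff order_refl)
    also have "\<dots> = (\<Sum>s\<in>K'. card (r s))"
      using K'G FG by (intro card_SigmaI) (auto simp: r_def)
    also have "\<dots> \<le> (\<Sum>s\<in>K'. 1 + (if s \<in> M then card F else 0))"
    proof (rule sum_mono)
      fix s assume "s \<in> K'"
      moreover have "card (r s) \<le> card F" using FG by (auto simp: r_def intro: card_mono)
      ultimately show "card (r s) \<le> 1 + (if s \<in> M then card F else 0)" by (auto simp: M_def)
    qed
    also have "\<dots> = (\<Sum>s\<in>K'. 1) + (\<Sum>s\<in>K'. if s \<in> M then card F else 0)"
      by (rule sum.distrib)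
    also have "\<dots> = card K' + card M * card F"
      using K'G by (simp add: sum.If_cases M_def Collect_conj_eq)
    finally have "real (card S) \<le> real (card K' + card M * card F)" by (simp only: of_nat_le_iff)
    moreover have "2 * real (card K') \<le> c * real (card R)"
      unfolding R(3) using mult_right_mono[OF Fm(1), of "real (card K')"] by (simp add: algebra_simps)
    ultimately have "real (card K') \<le> real (card M * card F)" using S(2) by simp
    then have "card K' \<le> card M * card F" by (simp only: of_nat_le_iff)
    then have "card K \<le> L * (card M * card F)"
      using K'(2) by (meson le_trans mult_le_mono2)
    then have "real (card K) \<le> real (L * (card M * card F))" by (simp only: of_nat_le_iff)
    then have cM: "c' * real (card K) \<le> real (card M)"
      using Fm(2) unfolding c'_def by (simp add: L_def divide_simps) (simp add: algebra_simps)
    have "\<exists>g g'. g \<in> F \<and> g' \<in> F \<and> g \<noteq> g' \<and> g \<otimes> s \<in> S \<and> g' \<otimes> s \<in> S" if "s \<in> M" for s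
    proof -
      have "finite (r s)" "\<not> card (r s) \<le> Suc 0" using that FG by (auto simp: M_def r_def)
      then obtain g g' where "g \<in> r s" "g' \<in> r s" "g \<noteq> g'" by (auto simp: card_le_Suc0_iff_eq)
      then show ?thesis unfolding r_def by blast
    qed
    then obtain g g' where g: "\<And>s. s \<in> M \<Longrightarrow> g s \<in> F" "\<And>s. s \<in> M \<Longrightarrow> g' s \<in> F"
        "\<And>s. s \<in> M \<Longrightarrow> g s \<noteq> g' s" "\<And>s. s \<in> M \<Longrightarrow> g s \<otimes> s \<in> S" "\<And>s. s \<in> M \<Longrightarrow> g' s \<otimes> s \<in> S"
      by metis
    define h h' where "h s = g s \<otimes> s" and "h' s = g' s \<otimes> s" for s
    \<comment> \<open>The choice of \<open>b'\<close> leaves the configuration at \<open>h s\<close>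
      in place, and \<open>w s\<close> is the solution of
      \<open>w s \<otimes> (b' s \<otimes> s) = b (h' s) \<otimes> h' s\<close>.\<close>
    define b' where "b' s = b (h s) \<otimes> g s" for s
    define w where "w s = b (h' s) \<otimes> g' s \<otimes> inv (g s) \<otimes> inv (b (h s))" for s
    define E' where "E' s = w s # E (h s)" for s
    have MG: "s \<in> carrier G" "g s \<in> carrier G" "g' s \<in> carrier G" "h s \<in> S" "h' s \<in> S"
        "b (h s) \<in> B" "b (h' s) \<in> B" "b (h s) \<in> carrier G" "b (h' s) \<in> carrier G"
        "E (h s) \<in> \<E>" "E (h' s) \<in> \<E>" "w s \<in> carrier G" if "s \<in> M" for s
    proof -
      show *: "s \<in> carrier G" "g s \<in> carrier G" "g' s \<in> carrier G" "h s \<in> S" "h' s \<in> S"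
        using that K'G FG g by (auto simp: M_def h_def h'_def)
      show **: "b (h s) \<in> B" "b (h' s) \<in> B" "E (h s) \<in> \<E>" "E (h' s) \<in> \<E>" using * bE(1,2) by auto
      then show "b (h s) \<in> carrier G" "b (h' s) \<in> carrier G" using B by auto
      then show "w s \<in> carrier G" using * by (simp add: w_def)
    qed
    have shift: "w s \<otimes> (b' s \<otimes> s) = \<one> \<otimes> (b (h' s) \<otimes> h' s)"
        "x \<otimes> (b' s \<otimes> s) = x \<otimes> (b (h s) \<otimes> h s)" if "s \<in> M" for s x
    proof -
      note G = MG[OF that]
      show "x \<otimes> (b' s \<otimes> s) = x \<otimes> (b (h s) \<otimes> h s)"
        using G by (simp add: b'_def h_def m_assoc)
      show "w s \<otimes> (b' s \<otimes> s) = \<one> \<otimes> (b (h' s) \<otimes> h' s)"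
        using G by (simp add: b'_def w_def h'_def m_assoc inv_mult_cancel_left)
    qed
    have new: "w s \<notin> set (E (h s))" if s: "s \<in> M" for s
    proof
      assume w: "w s \<in> set (E (h s))"
      note G = MG[OF s]
      have "g' s = (inv (b (h' s)) \<otimes> w s \<otimes> b (h s)) \<otimes> g s"
        using G by (simp add: w_def m_assoc inv_mult_cancel_left)
      moreover have "inv (b (h' s)) \<otimes> w s \<otimes> b (h s) \<in> Q"
        unfolding Q_def using G w by force
      ultimately show False using F(3)[rule_format, OF g(1,2,3)[OF s]] by blast
    qed
    \<comment> \<open>The extended copies use only points of the old union: the new element lands
      where \<open>\<one>\<close> lands in the copy at \<open>h' s\<close>. This is why every
      configuration contains \<open>\<one>\<close>.\<close>
    have "(\<Union>s\<in>M. (\<lambda>x. x \<otimes> (b' s \<otimes> s)) ` set (E' s)) \<subseteq> (\<Union>s\<in>S. (\<lambda>x. x \<otimes> (b s \<otimes> s)) ` set (E s))"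
    proof clarify
      fix s x assume s: "s \<in> M" and x: "x \<in> set (E' s)"
      show "x \<otimes> (b' s \<otimes> s) \<in> (\<Union>s\<in>S. (\<lambda>x. x \<otimes> (b s \<otimes> s)) ` set (E s))"
      proof (cases "x = w s")
        case True
        then show ?thesis using shift(1)[OF s] MG[OF s] \<E>(3) by auto
      next
        case False
        then have "x \<in> set (E (h s))" using x by (simp add: E'_def)
        then show ?thesis using shift(2)[OF s] MG(4)[OF s] by auto
      qed
    qed
    then have "(\<Union>s\<in>M. (\<lambda>x. x \<otimes> (b' s \<otimes> s)) ` set (E' s)) \<in> \<I>"
      by (rule hered[OF bE(3)])
    moreover have "b' \<in> M \<rightarrow> B'"
      unfolding B'_def b'_def using MG(6) g(1) by auto
    moreover have "w s \<in> W" if "s \<in> M" for s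
      unfolding W_def w_def using MG(6,7)[OF that] g(1,2)[OF that] by force
    then have "E' \<in> M \<rightarrow> \<E>'"
      unfolding \<E>'_def using new MG(10) by (auto simp: E'_def)
    ultimately have "pattern_copy G \<I> \<E>' B' M"
      unfolding pattern_copy_def by (intro bexI)
    moreover have "M \<subseteq> K" using K'(1) by (auto simp: M_def)
    ultimately show ?thesis using cM by blast
  qed
  then have "dense_patterns G \<I> \<E>'"
    unfolding dense_patterns_def using B' c' by blast
  then show ?thesis using W unfolding \<E>'_def by blast
qed

text \<open>Read \<open>p\<close> as the map to the parent. Some point of level 0 has descendants at
  all levels, and each such point has a child of the same kind, so dependent choice gives a
  branch.\<close>

lemma koenig:
  fixes T :: "nat \<Rightarrow> 'a set"
  assumes fin: "\<And>n. finite (T n)" and ne: "\<And>n. T n \<noteq> {}" and p: "\<And>n. p \<in> T (Suc n) \<rightarrow> T n"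
  obtains x where "\<And>n. x n \<in> T n" "\<And>n. p (x (Suc n)) = x n"
proof -
  define good where "good n x \<longleftrightarrow> (\<forall>m. \<exists>y\<in>T (n + m). (p ^^ m) y = x)" for n x
  have pow: "(p ^^ k) y \<in> T n" if "y \<in> T (n + k)" for n k y
    using that
  proof (induction k arbitrary: y)
    case (Suc k)
    have "p y \<in> T (n + k)" using p[of "n + k"] Suc.prems by auto
    then have "(p ^^ k) (p y) \<in> T n" by (rule Suc.IH)
    then show ?case by (simp add: funpow_swap1)
  qed simp
  \<comment> \<open>By the pigeonhole principle some \<open>x \<in> C\<close> has descendants at
    infinitely many levels; the images of these under powers of \<open>p\<close> are descendants at
    all levels between.\<close>
  have key: "\<exists>x\<in>C. good n x"
    if C: "finite C" and ex: "\<And>m. \<exists>x\<in>C. \<exists>y\<in>T (n + m). (p ^^ m) y = x" for n C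
  proof -
    obtain x where x: "x \<in> C" "infinite {m \<in> UNIV. \<exists>y\<in>T (n + m). (p ^^ m) y = x}"
      using pigeonhole_infinite_rel[of "UNIV :: nat set" C "\<lambda>m x. \<exists>y\<in>T (n + m). (p ^^ m) y = x"] C ex
      by auto
    have "good n x"
      unfolding good_def
    proof
      fix m
      obtain k y where k: "m \<le> k" "y \<in> T (n + k)" "(p ^^ k) y = x"
        using x(2) unfolding infinite_nat_iff_unbounded_le by blast
      have "(p ^^ (k - m)) y \<in> T (n + m)" using k(1,2) by (intro pow) simp
      moreover have "(p ^^ m) ((p ^^ (k - m)) y) = x"
        using k(1,3) funpow_add[of m "k - m" p] by simp
      ultimately show "\<exists>y\<in>T (n + m). (p ^^ m) y = x" by blast
    qed
    then show ?thesis using x(1) by blast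
  qed
  have "\<exists>x. \<forall>n. (x n \<in> T n \<and> good n (x n)) \<and> p (x (Suc n)) = x n"
  proof (rule dependent_nat_choice)
    have "\<exists>x\<in>T 0. \<exists>y\<in>T (0 + m). (p ^^ m) y = x" for m
    proof -
      obtain y where y: "y \<in> T (0 + m)" using ne by auto
      from pow[OF this] y show ?thesis by blast
    qed
    from key[OF fin this] show "\<exists>x. x \<in> T 0 \<and> good 0 x" by blast
  next
    fix x n assume "x \<in> T n \<and> good n x"
    then have x: "good n x" by simp
    have "\<exists>z\<in>{z \<in> T (Suc n). p z = x}. good (Suc n) z"
    proof (rule key)
      show "finite {z \<in> T (Suc n). p z = x}" using fin by simp
      fix m
      obtain y where y: "y \<in> T (n + Suc m)" "(p ^^ Suc m) y = x"
        using x unfolding good_def by blast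
      then have "y \<in> T (Suc n + m)" by simp
      moreover from pow[OF this] y(2) have "(p ^^ m) y \<in> {z \<in> T (Suc n). p z = x}" by simp
      ultimately show "\<exists>z\<in>{z \<in> T (Suc n). p z = x}. \<exists>y\<in>T (Suc n + m). (p ^^ m) y = z"
        by blast
    qed
    then show "\<exists>z. (z \<in> T (Suc n) \<and> good (Suc n) z) \<and> p z = x" by blast
  qed
  then show thesis using that by blast
qed

text \<open>The configuration \<open>[\<one>]\<close> is dense by assumption, and repeated extension
  gives finite levels of lists. Those with entries forming a set in \<open>\<I>\<close> exist at
  each level and, by heredity, are preserved by \<open>tl\<close>; a branch of this tree is an
  increasing chain of sets in \<open>\<I>\<close>.\<close>

lemma (in group) infinite_set_of_dense_family:
  assumes inf: "infinite (carrier G)" and "0 < c"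
    and hered: "\<And>I J. I \<in> \<I> \<Longrightarrow> J \<subseteq> I \<Longrightarrow> J \<in> \<I>"
    and transl: "\<And>I t. I \<in> \<I> \<Longrightarrow> t \<in> carrier G \<Longrightarrow> (\<lambda>x. x \<otimes> t) ` I \<in> \<I>"
    and dense: "\<And>K. finite K \<Longrightarrow> K \<subseteq> carrier G \<Longrightarrow> \<exists>I\<in>\<I>. I \<subseteq> K \<and> c * real (card K) \<le> real (card I)"
  obtains H where "infinite H" "H \<subseteq> carrier G" "\<And>J. finite J \<Longrightarrow> J \<subseteq> H \<Longrightarrow> J \<in> \<I>"
proof -
  \<comment> \<open>Lists at level \<open>n\<close> have length \<open>Suc n\<close>, because level
    0 already contains the unit. Distinctness makes the union along a branch infinite.\<close>
  define P where "P n \<E> \<longleftrightarrow> finite \<E> \<and> dense_patterns G \<I> \<E> \<and>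
    (\<forall>xs\<in>\<E>. set xs \<subseteq> carrier G \<and> \<one> \<in> set xs \<and> distinct xs \<and> length xs = Suc n)" for n \<E>
  have "\<exists>\<E>. \<forall>n. P n (\<E> n) \<and> tl ` \<E> (Suc n) \<subseteq> \<E> n"
  proof (rule dependent_nat_choice)
    have "dense_patterns G \<I> {[\<one>]}"
      unfolding dense_patterns_def
    proof (rule exI[of _ "{\<one>}"], rule exI[of _ c], intro conjI allI impI)
      fix K assume K: "finite K" "K \<subseteq> carrier G"
      obtain S where S: "S \<in> \<I>" "S \<subseteq> K" "c * real (card K) \<le> real (card S)"
        using dense[OF K] by blast
      have "(\<Union>s\<in>S. (\<lambda>x. x \<otimes> (\<one> \<otimes> s)) ` set [\<one>]) = S"
        using S(2) K(2) by (auto simp: subset_iff)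
      then have "pattern_copy G \<I> {[\<one>]} {\<one>} S"
        unfolding pattern_copy_def using S(1)
        by (intro bexI[of _ "\<lambda>_. \<one>"] bexI[of _ "\<lambda>_. [\<one>]"]) auto
      with S show "\<exists>S\<subseteq>K. c * real (card K) \<le> real (card S) \<and> pattern_copy G \<I> {[\<one>]} {\<one>} S"
        by blast
    qed (use \<open>0 < c\<close> in auto)
    then show "\<exists>\<E>. P 0 \<E>"
      unfolding P_def by (intro exI[of _ "{[\<one>]}"]) auto
  next
    fix \<E> n assume "P n \<E>"
    then have \<E>: "finite \<E>" "dense_patterns G \<I> \<E>"
      "\<And>xs. xs \<in> \<E> \<Longrightarrow> set xs \<subseteq> carrier G \<and> \<one> \<in> set xs \<and> distinct xs \<and> length xs = Suc n"
      unfolding P_def by auto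
    have "\<exists>W. finite W \<and> W \<subseteq> carrier G \<and>
        dense_patterns G \<I> {w # xs |w xs. w \<in> W \<and> xs \<in> \<E> \<and> w \<notin> set xs}"
      by (rule dense_patterns_extend[OF inf \<E>(1) _ _ _ \<E>(2)]) (use \<E>(3) hered in auto)
    then obtain W where W: "finite W" "W \<subseteq> carrier G"
        "dense_patterns G \<I> {w # xs |w xs. w \<in> W \<and> xs \<in> \<E> \<and> w \<notin> set xs}"
      by (elim exE conjE) (rule that)
    have "finite {w # xs |w xs. w \<in> W \<and> xs \<in> \<E> \<and> w \<notin> set xs}"
      by (rule finite_subset[of _ "(\<lambda>(w, xs). w # xs) ` (W \<times> \<E>)"]) (use W(1) \<E>(1) in auto)
    then show "\<exists>\<E>'. P (Suc n) \<E>' \<and> tl ` \<E>' \<subseteq> \<E>"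
      unfolding P_def using W(2,3) \<E>(3)
      by (intro exI[of _ "{w # xs |w xs. w \<in> W \<and> xs \<in> \<E> \<and> w \<notin> set xs}"]) (auto simp: subset_iff)
  qed
  then obtain \<E> where \<E>: "\<And>n. P n (\<E> n)" "\<And>n. tl ` \<E> (Suc n) \<subseteq> \<E> n" by blast
  define T where "T n = {xs \<in> \<E> n. set xs \<in> \<I>}" for n
  have "T n \<noteq> {}" for n
    using dense_patterns_imp_member[OF _ _ transl, where \<E> = "\<E> n"] \<E>(1)[of n] unfolding P_def T_def by blast
  moreover have "finite (T n)" for n
    using \<E>(1)[of n] unfolding P_def T_def by simp
  moreover have "set (tl xs) \<subseteq> set xs" for xs :: "'a list"
    by (cases xs) auto
  then have "tl \<in> T (Suc n) \<rightarrow> T n" for n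
    using \<E>(2)[of n] hered unfolding T_def by blast
  ultimately obtain x where x: "\<And>n. x n \<in> T n" "\<And>n. tl (x (Suc n)) = x n"
    using koenig[where T = T and p = tl] by blast
  have mono: "mono (\<lambda>n. set (x n))"
    unfolding mono_iff_le_Suc using x(2) by (metis list.set_sel(2) list.sel(2) subsetI)
  have props: "set (x n) \<subseteq> carrier G" "card (set (x n)) = Suc n" "set (x n) \<in> \<I>" for n
    using x(1)[of n] \<E>(1)[of n] unfolding T_def P_def by (auto simp: distinct_card)
  show thesis
  proof (rule that[of "\<Union>n. set (x n)"])
    show "infinite (\<Union>n. set (x n))"
    proof
      assume "finite (\<Union>n. set (x n))"
      then have "card (set (x (card (\<Union>n. set (x n))))) \<le> card (\<Union>n. set (x n))"
        by (intro card_mono) auto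
      then show False using props(2) by simp
    qed
    show "(\<Union>n. set (x n)) \<subseteq> carrier G" using props(1) by auto
    fix J assume "finite J" "J \<subseteq> (\<Union>n. set (x n))"
    then have "\<exists>n. J \<subseteq> set (x n)"
    proof (induction J rule: finite_induct)
      case (insert a J)
      then obtain n k where "J \<subseteq> set (x n)" "a \<in> set (x k)" by auto
      then have "insert a J \<subseteq> set (x (max n k))"
        using monoD[OF mono, of n "max n k"] monoD[OF mono, of k "max n k"] by auto
      then show ?case by blast
    qed simp
    then show "J \<in> \<I>" using hered props(3) by blast
  qed
qed

section \<open>Independence sets of actions with positive naive entropy\<close>

text \<open>One member \<open>U\<close> is split off at a time: the part of \<open>C\<close> outside
  the other members is closed and lies in \<open>U\<close>, so normality gives it an open
  neighbourhood \<open>V\<close> with closure in \<open>U\<close>, and \<open>C - V\<close> is left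
  to the others. Hence the induction over all closed \<open>C\<close>.\<close>

lemma closed_shrinking:
  assumes normal: "normal_space (euclidean :: 'x::topological_space topology)"
    and "finite \<U>" "\<And>U. U \<in> \<U> \<Longrightarrow> open U" "closed C" "C \<subseteq> \<Union>\<U>"
  shows "\<exists>D :: 'x set \<Rightarrow> 'x set. (\<forall>U\<in>\<U>. closed (D U) \<and> D U \<subseteq> U) \<and> C \<subseteq> (\<Union>U\<in>\<U>. D U)"
  using assms(2-)
proof (induction \<U> arbitrary: C rule: finite_induct)
  case (insert U \<U>)
  have "closed (C - \<Union>\<U>)" "C - \<Union>\<U> \<subseteq> U" "open U"
    using insert.prems by (auto intro!: closed_Diff)
  then obtain V where V: "open V" "C - \<Union>\<U> \<subseteq> V" "closure V \<subseteq> U"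
    using normal unfolding normal_space_alt by (metis closed_closedin euclidean_closure_of open_openin)
  have "\<exists>D. (\<forall>U\<in>\<U>. closed (D U) \<and> D U \<subseteq> U) \<and> C - V \<subseteq> (\<Union>U\<in>\<U>. D U)"
    using V insert.prems by (intro insert.IH) auto
  then obtain D where D: "\<forall>U\<in>\<U>. closed (D U) \<and> D U \<subseteq> U" "C - V \<subseteq> (\<Union>U\<in>\<U>. D U)"
    by blast
  have "C \<subseteq> closure V \<union> (\<Union>U\<in>\<U>. D U)"
    using D(2) closure_subset[of V] by blast
  also have "\<dots> = (\<Union>W\<in>insert U \<U>. (D(U := closure V)) W)"
    using insert.hyps(2) by auto
  finally show ?case
    using D(1) V(3) insert.hyps(2) by (intro exI[of _ "D(U := closure V)"]) auto
qed auto

lemma cover_number_le: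
  assumes "\<W> \<subseteq> \<V>" "finite \<W>" "\<Union>\<W> = UNIV"
  shows "cover_number \<V> \<le> card \<W>"
  unfolding cover_number_def using assms by (intro Least_le) blast

context group_action
begin

lemma translate_cover_member:
  assumes "E = UNIV" "finite F" "F \<subseteq> carrier G" "u \<in> F \<rightarrow> \<U>"
  shows "(\<Inter>s\<in>F. \<phi> s -` u s) \<in> join_translates G \<phi> \<U> F"
  using assms(2-)
proof (induction F rule: finite_induct)
  case empty
  then show ?case by (simp add: join_translates_empty)
next
  case (insert s F)
  interpret group_hom G "BijGroup E" \<phi> by (rule group_hom)
  have s: "s \<in> carrier G" using insert.prems by simp
  have "\<phi> s -` u s = \<phi> (inv s) ` u s"
  proof -
    have "\<phi> s (\<phi> (inv s) x) = x" "\<phi> (inv s) (\<phi> s x) = x" for x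
      using orbit_sym_aux[OF _ _ refl, of s x] orbit_sym_aux[OF _ _ refl, of "inv s" x] s assms(1) by auto
    then show ?thesis by (auto simp: image_iff) metis
  qed
  then have "\<phi> s -` u s \<in> (\<lambda>U. \<phi> (inv s) ` U) ` \<U>" using insert.prems by auto
  moreover have "(\<Inter>s\<in>F. \<phi> s -` u s) \<in> join_translates G \<phi> \<U> F"
    using insert by auto
  ultimately show ?case
    unfolding join_translates_insert[OF insert.hyps] cover_join_def by auto
qed

text \<open>If \<open>x\<close> realizes the pattern \<open>\<omega> (s \<otimes> t)\<close> for
  \<open>s \<in> J\<close>, then \<open>\<phi> (inv t) x\<close> realizes \<open>\<omega>\<close> on
  the translate of \<open>J\<close>.\<close>

lemma shattered_translate:
  assumes "E = UNIV" "J \<subseteq> carrier G" "t \<in> carrier G"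
    and "shattered (\<lambda>s i. \<phi> s -` B i) UNIV J"
  shows "shattered (\<lambda>s i. \<phi> s -` B i) UNIV ((\<lambda>s. s \<otimes> t) ` J)"
  unfolding shattered_def
proof
  interpret group_hom G "BijGroup E" \<phi> by (rule group_hom)
  fix \<omega> :: "'a \<Rightarrow> bool"
  obtain x where x: "\<And>s. s \<in> J \<Longrightarrow> \<phi> s x \<in> B (\<omega> (s \<otimes> t))"
    using shatteredE[OF assms(4), of "\<lambda>s. \<omega> (s \<otimes> t)"] by auto
  have "\<phi> (s \<otimes> t) (\<phi> (inv t) x) = \<phi> s x" if "s \<in> J" for s
    using composition_rule[of "\<phi> (inv t) x" s t] orbit_sym_aux[of "inv t" x] assms(1-3) that by auto
  with x have "\<forall>v\<in>(\<lambda>s. s \<otimes> t) ` J. \<phi> (inv t) x \<in> \<phi> v -` B (\<omega> v)"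
    by auto
  then show "\<exists>y\<in>UNIV. \<forall>v\<in>(\<lambda>s. s \<otimes> t) ` J. y \<in> \<phi> v -` B (\<omega> v)" by blast
qed

text \<open>The Sauer--Shelah bound is applied to the index set \<open>F \<times> \<U>\<close>.
  Every \<open>\<Omega>\<close> with \<open>avoided A UNIV (F \<times> \<U>) \<Omega>\<close> yields
  a subcover of the join with at most \<open>card \<Omega>\<close> members, so it must be
  large.\<close>

lemma large_shattered_of_cover_number:
  fixes D :: "'c set \<Rightarrow> 'c set" and r :: real
  assumes "E = UNIV" "finite \<U>" "(\<Union>U\<in>\<U>. D U) = UNIV" "\<And>U. U \<in> \<U> \<Longrightarrow> D U \<subseteq> U" "0 < r"
    and large: "\<And>F. F \<subseteq> carrier G \<Longrightarrow> finite F \<Longrightarrow> F \<noteq> {} \<Longrightarrow>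
      exp (r * real (card F)) \<le> real (cover_number (join_translates G \<phi> \<U> F))"
  obtains c :: real where "0 < c"
    "\<And>F. F \<subseteq> carrier G \<Longrightarrow> finite F \<Longrightarrow> \<exists>J\<subseteq>F. \<exists>U\<in>\<U>.
       shattered (\<lambda>s i. \<phi> s -` (if i then D U else - U)) UNIV J \<and> c * real (card F) \<le> real (card J)"
proof -
  have ne: "\<U> \<noteq> {}" using assms(3) by auto
  \<comment> \<open>Indexing by pairs treats all \<open>U\<close> at once: a function that avoids the sets \<open>A (s, U) i\<close> at a point
    names, for each \<open>s\<close>, some \<open>U\<close> containing the image of the point under \<open>\<phi> s\<close>.\<close>
  define A :: "'a \<times> 'c set \<Rightarrow> bool \<Rightarrow> 'c set"
    where "A = (\<lambda>(s, U) i. if U \<in> \<U> then \<phi> s -` (if i then D U else - U) else {})"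
  define b where "b = r / real (card \<U>)"
  have "card \<U> > 0" using ne assms(2) by (simp add: card_gt_0_iff)
  then have b: "0 < b" "b * real (card \<U>) = r"
    using assms(5) by (auto simp: b_def)
  obtain c where c: "0 < c" and shat: "\<And>(A :: 'a \<times> 'c set \<Rightarrow> bool \<Rightarrow> 'c set) Y Z.
       finite Z \<Longrightarrow> Z \<noteq> {} \<Longrightarrow> (\<And>z. A z True \<inter> A z False = {}) \<Longrightarrow>
       (\<And>\<Omega>. finite \<Omega> \<Longrightarrow> avoided A Y Z \<Omega> \<Longrightarrow> exp (b * real (card Z)) \<le> real (card \<Omega>)) \<Longrightarrow>
       \<exists>J\<subseteq>Z. shattered A Y J \<and> c * real (card Z) \<le> real (card J)"
    using avoided_exp_imp_large_shattered[OF b(1)] by blast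
  have "\<exists>J\<subseteq>F. \<exists>U\<in>\<U>. shattered (\<lambda>s i. \<phi> s -` (if i then D U else - U)) UNIV J \<and>
      c * real (card F) \<le> real (card J)" if F: "F \<subseteq> carrier G" "finite F" for F
  proof (cases "F = {}")
    case True
    then show ?thesis using ne by (auto simp: shattered_def)
  next
    case False
    have "exp (b * real (card (F \<times> \<U>))) \<le> real (card \<Omega>)"
      if \<Omega>: "finite \<Omega>" "avoided A UNIV (F \<times> \<U>) \<Omega>" for \<Omega>
    proof -
      define u where "u \<omega> s = (SOME U. U \<in> \<U> \<and> \<not> \<omega> (s, U))" for \<omega> :: "'a \<times> 'c set \<Rightarrow> bool" and s
      \<comment> \<open>A function outside \<open>\<Omega>'\<close> is constantly
        \<open>True\<close> on \<open>\<U>\<close> at some \<open>s\<close>. It avoids no point,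
        since the image of the point under \<open>s\<close> lies in some \<open>D U\<close>.\<close>
      define \<Omega>' where "\<Omega>' = {\<omega> \<in> \<Omega>. \<forall>s\<in>F. \<exists>U\<in>\<U>. \<not> \<omega> (s, U)}"
      have u: "u \<omega> s \<in> \<U> \<and> \<not> \<omega> (s, u \<omega> s)" if "\<omega> \<in> \<Omega>'" "s \<in> F" for \<omega> s
        unfolding u_def by (rule someI_ex) (use that in \<open>auto simp: \<Omega>'_def\<close>)
      define \<W> where "\<W> = (\<lambda>\<omega>. \<Inter>s\<in>F. \<phi> s -` u \<omega> s) ` \<Omega>'"
      have "x \<in> \<Union>\<W>" for x
      proof -
        obtain \<omega> where \<omega>: "\<omega> \<in> \<Omega>" "\<And>s U. s \<in> F \<Longrightarrow> U \<in> \<U> \<Longrightarrow> x \<notin> A (s, U) (\<omega> (s, U))"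
          using \<Omega>(2) unfolding avoided_def by blast
        have "\<exists>U\<in>\<U>. \<not> \<omega> (s, U)" if "s \<in> F" for s
        proof -
          obtain U where "U \<in> \<U>" "\<phi> s x \<in> D U" using assms(3) by auto
          then show ?thesis using \<omega>(2)[OF that, of U] by (auto simp: A_def split: if_splits)
        qed
        then have "\<omega> \<in> \<Omega>'" using \<omega>(1) by (simp add: \<Omega>'_def)
        moreover have "\<phi> s x \<in> u \<omega> s" if "s \<in> F" for s
          using \<omega>(2)[OF that, of "u \<omega> s"] u[OF \<open>\<omega> \<in> \<Omega>'\<close> that] by (auto simp: A_def)
        ultimately show ?thesis unfolding \<W>_def by auto
      qed
      moreover have "\<W> \<subseteq> join_translates G \<phi> \<U> F"
        unfolding \<W>_def using u by (auto intro!: translate_cover_member[OF assms(1) F(2,1)])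
      moreover have fin: "finite \<Omega>'" using \<Omega>(1) by (simp add: \<Omega>'_def)
      ultimately have "cover_number (join_translates G \<phi> \<U> F) \<le> card \<W>"
        by (intro cover_number_le) (auto simp: \<W>_def)
      also have "\<dots> \<le> card \<Omega>'" unfolding \<W>_def using fin by (rule card_image_le)
      also have "\<dots> \<le> card \<Omega>" using \<Omega>(1) by (intro card_mono) (auto simp: \<Omega>'_def)
      finally have "real (cover_number (join_translates G \<phi> \<U> F)) \<le> real (card \<Omega>)" by simp
      moreover have "b * real (card (F \<times> \<U>)) = r * real (card F)"
        using b(2) by (simp add: card_cartesian_product ac_simps)
      ultimately show ?thesis using large[OF F False] by simp
    qed
    moreover have "A z True \<inter> A z False = {}" for z
      using assms(4) by (cases z) (auto simp: A_def)
    ultimately obtain J where J: "J \<subseteq> F \<times> \<U>" "shattered A UNIV J" "c * real (card (F \<times> \<U>)) \<le> real (card J)"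
      using shat[of "F \<times> \<U>" A UNIV] F(2) False ne assms(2) by auto
    define J' where "J' U = {s. (s, U) \<in> J}" for U
    have J': "J' U \<subseteq> F" "finite (J' U)" for U
      using J(1) F(2) by (auto simp: J'_def intro: finite_subset)
    \<comment> \<open>Averaging over \<open>\<U>\<close>: \<open>J\<close> splits into the fibres
      \<open>J' U\<close>, so they cannot all be small.\<close>
    have "\<exists>U\<in>\<U>. c * real (card F) \<le> real (card (J' U))"
    proof (rule ccontr)
      assume "\<not> ?thesis"
      then have "(\<Sum>U\<in>\<U>. real (card (J' U))) < (\<Sum>U\<in>\<U>. c * real (card F))"
        using assms(2) ne by (intro sum_strict_mono) auto
      also have "\<dots> = c * real (card (F \<times> \<U>))" by (simp add: card_cartesian_product)
      also have "\<dots> \<le> real (card J)" by (rule J(3))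
      also have "J = (\<lambda>(U, s). (s, U)) ` (SIGMA U:\<U>. J' U)"
        using J(1) by (auto simp: J'_def)
      then have "card J \<le> card (SIGMA U:\<U>. J' U)"
        using assms(2) J'(2) by (metis card_image_le finite_SigmaI)
      then have "real (card J) \<le> (\<Sum>U\<in>\<U>. real (card (J' U)))"
        using assms(2) J'(2) by (simp add: card_SigmaI flip: of_nat_sum)
      finally show False by simp
    qed
    then obtain U where U: "U \<in> \<U>" "c * real (card F) \<le> real (card (J' U))" by blast
    have "shattered (\<lambda>s i. \<phi> s -` (if i then D U else - U)) UNIV (J' U)"
      unfolding shattered_def
    proof
      fix \<omega> :: "'a \<Rightarrow> bool"
      obtain x where "\<And>z. z \<in> J \<Longrightarrow> x \<in> A z (\<omega> (fst z))"
        using shatteredE[OF J(2), of "\<lambda>z. \<omega> (fst z)"] by blast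
      then have "\<forall>s\<in>J' U. x \<in> A (s, U) (\<omega> s)" by (force simp: J'_def)
      then show "\<exists>y\<in>UNIV. \<forall>z\<in>J' U. y \<in> \<phi> z -` (if \<omega> z then D U else - U)"
        using U(1) by (intro bexI[of _ x]) (auto simp: A_def)
    qed
    then show ?thesis using U J'(1) by blast
  qed
  then show thesis using that c by blast
qed

lemma infinite_shattered_set:
  fixes D :: "'c set \<Rightarrow> 'c set" and r :: real
  assumes "E = UNIV" "infinite (carrier G)" "finite \<U>" "(\<Union>U\<in>\<U>. D U) = UNIV"
    and "\<And>U. U \<in> \<U> \<Longrightarrow> D U \<subseteq> U" "0 < r"
    and "\<And>F. F \<subseteq> carrier G \<Longrightarrow> finite F \<Longrightarrow> F \<noteq> {} \<Longrightarrow>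
      exp (r * real (card F)) \<le> real (cover_number (join_translates G \<phi> \<U> F))"
  obtains H U where "infinite H" "H \<subseteq> carrier G" "U \<in> \<U>"
    "\<And>J. finite J \<Longrightarrow> J \<subseteq> H \<Longrightarrow> shattered (\<lambda>s i. \<phi> s -` (if i then D U else - U)) UNIV J"
proof -
  interpret group_hom G "BijGroup E" \<phi> by (rule group_hom)
  define ind where "ind U J \<longleftrightarrow> shattered (\<lambda>s i. \<phi> s -` (if i then D U else - U)) UNIV J" for U J
  have ind_mono: "ind U J'" if "ind U J" "J' \<subseteq> J" for U J J'
    using that unfolding ind_def shattered_def by (meson subsetD)
  define \<I> where "\<I> = {J. J \<subseteq> carrier G \<and> (\<exists>U\<in>\<U>. ind U J)}"
  obtain c where c: "0 < c" "\<And>F. F \<subseteq> carrier G \<Longrightarrow> finite F \<Longrightarrow> \<exists>J\<subseteq>F. \<exists>U\<in>\<U>. ind U J \<and> c * real (card F) \<le> real (card J)"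
    using large_shattered_of_cover_number[OF assms(1,3-7)] unfolding ind_def by blast
  obtain H where H: "infinite H" "H \<subseteq> carrier G" "\<And>J. finite J \<Longrightarrow> J \<subseteq> H \<Longrightarrow> J \<in> \<I>"
  proof (rule G.infinite_set_of_dense_family[OF assms(2) c(1), of \<I>])
    show "J \<in> \<I>" if "I \<in> \<I>" "J \<subseteq> I" for I J
      using that ind_mono unfolding \<I>_def by blast
    show "(\<lambda>x. x \<otimes> t) ` I \<in> \<I>" if "I \<in> \<I>" "t \<in> carrier G" for I t
    proof -
      obtain U where "U \<in> \<U>" "ind U I" "I \<subseteq> carrier G" using \<open>I \<in> \<I>\<close> unfolding \<I>_def by blast
      moreover from this have "ind U ((\<lambda>x. x \<otimes> t) ` I)"
        using \<open>t \<in> carrier G\<close> unfolding ind_def by (intro shattered_translate[OF assms(1)])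
      ultimately show ?thesis
        using \<open>t \<in> carrier G\<close> unfolding \<I>_def by auto
    qed
    show "\<exists>I\<in>\<I>. I \<subseteq> K \<and> c * real (card K) \<le> real (card I)" if "finite K" "K \<subseteq> carrier G" for K
      using c(2)[OF that(2,1)] that(2) unfolding \<I>_def by blast
  qed blast
  \<comment> \<open>So far \<open>U\<close> may depend on the finite set. If each \<open>U\<close>
    failed on some \<open>J U\<close>, the finite union of these sets would still be independent for
    one \<open>U\<close>, and then so would its subset \<open>J U\<close>.\<close>
  have "\<exists>U\<in>\<U>. \<forall>J. finite J \<and> J \<subseteq> H \<longrightarrow> ind U J"
  proof (rule ccontr)
    assume "\<not> ?thesis"
    then obtain J where J: "\<And>U. U \<in> \<U> \<Longrightarrow> finite (J U) \<and> J U \<subseteq> H \<and> \<not> ind U (J U)" by metis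
    then have "(\<Union>U\<in>\<U>. J U) \<in> \<I>" using assms(3) by (intro H(3)) auto
    then obtain U where "U \<in> \<U>" "ind U (\<Union>U\<in>\<U>. J U)" unfolding \<I>_def by blast
    then show False using ind_mono[of U _ "J U"] J by blast
  qed
  then obtain U where U: "U \<in> \<U>" "\<forall>J. finite J \<and> J \<subseteq> H \<longrightarrow> ind U J" by blast
  show thesis by (rule that[OF H(1,2) U(1)]) (use U(2) in \<open>simp add: ind_def\<close>)
qed

end

section \<open>Isomorphic copies of \<open>\<ell>\<^sup>1\<close>\<close>

text \<open>The library instance requires the domain to be a metric space.\<close>

instance bcontfun :: (topological_space, complete_space) complete_space
proof
  fix f :: "nat \<Rightarrow> 'a \<Rightarrow>\<^sub>C 'b"
  assume "Cauchy f"
  then have "uniformly_Cauchy_on UNIV (\<lambda>n. apply_bcontfun (f n))"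
    unfolding Cauchy_def uniformly_Cauchy_on_def by (meson dist_fun_lt_imp_dist_val_lt)
  then obtain g where "uniform_limit UNIV (\<lambda>n. apply_bcontfun (f n)) g sequentially"
    using Cauchy_uniformly_convergent unfolding uniformly_convergent_on_def by blast
  then obtain l where "f \<longlonglongrightarrow> l"
    using uniform_limit_bcontfunE sequentially_bot by blast
  then show "convergent f" by (rule convergentI)
qed

instance bcontfun :: (topological_space, banach) banach ..

section \<open>The space \<open>ell1 H\<close> and its completeness\<close>

lemma ell1_add: "a \<in> ell1 H \<Longrightarrow> b \<in> ell1 H \<Longrightarrow> (\<lambda>s. a s + b s) \<in> ell1 H"
  unfolding ell1_def
  by (auto intro: summable_on_comparison_test[OF summable_on_add, of "\<lambda>s. \<bar>a s\<bar>" H "\<lambda>s. \<bar>b s\<bar>"])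

lemma ell1_scale: "a \<in> ell1 H \<Longrightarrow> (\<lambda>s. c * a s) \<in> ell1 H"
  unfolding ell1_def by (auto simp: abs_mult intro: summable_on_cmult_right)

lemma ell1_diff: "a \<in> ell1 H \<Longrightarrow> b \<in> ell1 H \<Longrightarrow> (\<lambda>s. a s - b s) \<in> ell1 H"
  using ell1_add[of a H "\<lambda>s. (-1) * b s"] ell1_scale[of b H "-1"] by simp

lemma ell1_abs_le_norm:
  assumes "a \<in> ell1 H" "finite F" "F \<subseteq> H"
  shows "(\<Sum>s\<in>F. \<bar>a s\<bar>) \<le> ell1_norm H a"
  using assms unfolding ell1_def ell1_norm_def by (auto intro: finite_sum_le_infsum)

lemma ell1_bounded_by:
  assumes "\<And>s. s \<notin> H \<Longrightarrow> a s = 0" "\<And>F. finite F \<Longrightarrow> F \<subseteq> H \<Longrightarrow> (\<Sum>s\<in>F. \<bar>a s\<bar>) \<le> C"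
  shows "a \<in> ell1 H" "ell1_norm H a \<le> C"
proof -
  have "(\<lambda>s. \<bar>a s\<bar>) summable_on H"
    using assms(2) by (intro nonneg_bdd_above_summable_on) (auto simp: bdd_above_def)
  then show "a \<in> ell1 H" "ell1_norm H a \<le> C"
    using assms unfolding ell1_def ell1_norm_def by (auto intro: infsum_le_finite_sums)
qed

text \<open>The limit is taken pointwise. The Cauchy estimate survives on finite partial sums, and
  these control the norm by \<open>ell1_bounded_by\<close>.\<close>

lemma ell1_complete:
  assumes a: "\<And>n. a n \<in> ell1 H"
    and cauchy: "\<And>e. 0 < e \<Longrightarrow> \<exists>N. \<forall>m\<ge>N. \<forall>n\<ge>N. ell1_norm H (\<lambda>s. a m s - a n s) \<le> e"
  shows "\<exists>l\<in>ell1 H. (\<lambda>n. ell1_norm H (\<lambda>s. a n s - l s)) \<longlonglongrightarrow> 0"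
proof -
  have pt: "\<bar>a m s - a n s\<bar> \<le> ell1_norm H (\<lambda>s. a m s - a n s)" if "s \<in> H" for m n s
    using ell1_abs_le_norm[OF ell1_diff[OF a a], of "{s}" m n] that by simp
  have "Cauchy (\<lambda>n. a n s)" if "s \<in> H" for s
  proof (rule CauchyI')
    fix e :: real assume "0 < e"
    then obtain N where N: "\<forall>m\<ge>N. \<forall>n\<ge>N. ell1_norm H (\<lambda>s. a m s - a n s) \<le> e / 2"
      using cauchy[of "e/2"] by auto
    show "\<exists>M. \<forall>m\<ge>M. \<forall>n>m. dist (a m s) (a n s) < e"
    proof (intro exI allI impI)
      fix m n assume "N \<le> m" "m < n"
      then have "\<bar>a m s - a n s\<bar> \<le> e / 2"
        using N pt[OF that, of m n] by (meson less_imp_le order_trans)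
      then show "dist (a m s) (a n s) < e"
        using \<open>0 < e\<close> by (simp add: dist_real_def)
    qed
  qed
  then have "\<forall>s\<in>H. \<exists>l. (\<lambda>n. a n s) \<longlonglongrightarrow> l"
    by (simp add: Cauchy_convergent_iff convergent_def)
  then obtain l0 where l0: "\<And>s. s \<in> H \<Longrightarrow> (\<lambda>n. a n s) \<longlonglongrightarrow> l0 s" by metis
  define l where "l s = (if s \<in> H then l0 s else 0)" for s
  have lim: "(\<lambda>n. a n s) \<longlonglongrightarrow> l s" if "s \<in> H" for s
    using l0 that by (simp add: l_def)
  have tail: "\<exists>N. \<forall>m\<ge>N. (\<lambda>s. a m s - l s) \<in> ell1 H \<and> ell1_norm H (\<lambda>s. a m s - l s) \<le> e" if "0 < e" for e
  proof -
    obtain N where N: "\<And>m n. m \<ge> N \<Longrightarrow> n \<ge> N \<Longrightarrow> ell1_norm H (\<lambda>s. a m s - a n s) \<le> e"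
      using cauchy[OF \<open>0 < e\<close>] by blast
    have "(\<lambda>s. a m s - l s) \<in> ell1 H \<and> ell1_norm H (\<lambda>s. a m s - l s) \<le> e" if "m \<ge> N" for m
    proof -
      have 0: "a m s - l s = 0" if "s \<notin> H" for s
        using a[of m] that by (simp add: ell1_def l_def)
      have "(\<Sum>s\<in>F. \<bar>a m s - l s\<bar>) \<le> e" if F: "finite F" "F \<subseteq> H" for F
      proof (rule LIMSEQ_le_const2)
        show "(\<lambda>n. \<Sum>s\<in>F. \<bar>a m s - a n s\<bar>) \<longlonglongrightarrow> (\<Sum>s\<in>F. \<bar>a m s - l s\<bar>)"
          using F(2) by (intro tendsto_intros lim) auto
        show "\<exists>N. \<forall>n\<ge>N. (\<Sum>s\<in>F. \<bar>a m s - a n s\<bar>) \<le> e"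
          using ell1_abs_le_norm[OF ell1_diff[OF a a] F] N[OF \<open>m \<ge> N\<close>] by (meson order_trans)
      qed
      then show ?thesis using ell1_bounded_by[of H "\<lambda>s. a m s - l s" e] 0 by blast
    qed
    then show ?thesis by blast
  qed
  obtain N where "(\<lambda>s. a N s - l s) \<in> ell1 H" using tail[of 1] by auto
  from ell1_diff[OF a this, of N] have "l \<in> ell1 H" by simp
  moreover have "(\<lambda>n. ell1_norm H (\<lambda>s. a n s - l s)) \<longlonglongrightarrow> 0"
  proof (rule LIMSEQ_I)
    fix r :: real assume "0 < r"
    then obtain N where "\<forall>m\<ge>N. ell1_norm H (\<lambda>s. a m s - l s) \<le> r / 2"
      using tail[of "r/2"] by auto
    moreover have "0 \<le> ell1_norm H b" for b :: "'a \<Rightarrow> real"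
      unfolding ell1_norm_def by (rule infsum_nonneg) simp
    ultimately show "\<exists>N. \<forall>n\<ge>N. norm (ell1_norm H (\<lambda>s. a n s - l s) - 0) < r"
      using \<open>0 < r\<close> by (intro exI[of _ N]) (auto intro: le_less_trans)
  qed
  ultimately show ?thesis by blast
qed

text \<open>Let \<open>T a\<close> be the sum of all \<open>a s *\<^sub>R f s\<close>. The lower
  bounds for finite sums pass to the limit over finite subsets, so \<open>T\<close> is isometric;
  completeness of \<open>ell1 H\<close> makes its range closed, hence equal to the closed
  span.\<close>

lemma ell1_isomorphism_if_lower_bound:
  fixes f :: "'g \<Rightarrow> 'b::banach"
  assumes upper: "\<And>s. s \<in> H \<Longrightarrow> norm (f s) \<le> 1"
    and lower: "\<And>F a. finite F \<Longrightarrow> F \<subseteq> H \<Longrightarrow> (\<Sum>s\<in>F. \<bar>a s\<bar>) \<le> norm (\<Sum>s\<in>F. a s *\<^sub>R f s)"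
  shows "\<exists>T. ell1_isomorphism H (closure (span (f ` H))) T \<and> (\<forall>s\<in>H. T (delta s) = f s)"
proof -
  define T where "T a = (\<Sum>\<^sub>\<infinity>s\<in>H. a s *\<^sub>R f s)" for a
  have abs: "(\<lambda>s. norm (a s *\<^sub>R f s)) summable_on H" if "a \<in> ell1 H" for a
    using that upper unfolding ell1_def
    by (intro Infinite_Sum.abs_summable_on_comparison_test'[of "\<lambda>s. \<bar>a s\<bar>"]) (auto intro: mult_left_le)
  have sums: "((\<lambda>s. a s *\<^sub>R f s) has_sum T a) H" if "a \<in> ell1 H" for a
    unfolding T_def by (rule has_sum_infsum[OF abs_summable_summable[OF abs[OF that]]])
  have add: "T (\<lambda>s. a s + b s) = T a + T b" if "a \<in> ell1 H" "b \<in> ell1 H" for a b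
    using has_sum_add[OF sums[OF that(1)] sums[OF that(2)]]
    by (simp add: T_def infsumI scaleR_left_distrib)
  have scale: "T (\<lambda>s. c * a s) = c *\<^sub>R T a" for c a
    unfolding T_def by (simp add: infsum_scaleR_right flip: scaleR_scaleR)
  have diff: "T (\<lambda>s. a s - b s) = T a - T b" if "a \<in> ell1 H" "b \<in> ell1 H" for a b
    using add[OF that(1) ell1_scale[OF that(2), of "-1"]] scale[of "-1" b] by simp
  have T_le: "norm (T a) \<le> ell1_norm H a" if "a \<in> ell1 H" for a
  proof -
    have "norm (T a) \<le> (\<Sum>\<^sub>\<infinity>s\<in>H. norm (a s *\<^sub>R f s))"
      unfolding T_def using abs[OF that] by (rule norm_infsum_bound)
    also have "\<dots> \<le> (\<Sum>\<^sub>\<infinity>s\<in>H. \<bar>a s\<bar>)"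
      using abs[OF that] that upper unfolding ell1_def by (intro infsum_mono) (auto intro: mult_left_le)
    finally show ?thesis by (simp add: ell1_norm_def)
  qed
  have T_ge: "ell1_norm H a \<le> norm (T a)" if "a \<in> ell1 H" for a
  proof (rule tendsto_le)
    show "finite_subsets_at_top H \<noteq> bot" by simp
    show "((\<lambda>F. norm (\<Sum>s\<in>F. a s *\<^sub>R f s)) \<longlongrightarrow> norm (T a)) (finite_subsets_at_top H)"
      using sums[OF that] unfolding has_sum_def by (rule tendsto_norm)
    have "((\<lambda>s. \<bar>a s\<bar>) has_sum ell1_norm H a) H"
      using that unfolding ell1_def ell1_norm_def by (simp add: has_sum_infsum)
    then show "((\<lambda>F. \<Sum>s\<in>F. \<bar>a s\<bar>) \<longlongrightarrow> ell1_norm H a) (finite_subsets_at_top H)"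
      unfolding has_sum_def .
    show "\<forall>\<^sub>F F in finite_subsets_at_top H. (\<Sum>s\<in>F. \<bar>a s\<bar>) \<le> norm (\<Sum>s\<in>F. a s *\<^sub>R f s)"
      using lower by (intro eventually_finite_subsets_at_top_weakI) auto
  qed
  have delta: "delta s \<in> ell1 H \<and> T (delta s) = f s" if "s \<in> H" for s
  proof -
    have "((\<lambda>t. \<bar>delta s t\<bar>) has_sum (\<Sum>t\<in>{s}. \<bar>delta s t\<bar>)) H"
      using that by (intro has_sum_finite_neutralI[of "{s}"]) (auto simp: delta_def)
    moreover have "((\<lambda>t. delta s t *\<^sub>R f t) has_sum (\<Sum>t\<in>{s}. delta s t *\<^sub>R f t)) H"
      using that by (intro has_sum_finite_neutralI[of "{s}"]) (auto simp: delta_def)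
    ultimately show ?thesis
      using that unfolding ell1_def T_def by (auto simp: delta_def infsumI summable_on_def)
  qed
  have inj: "inj_on T (ell1 H)"
  proof (rule inj_onI)
    fix a b assume ab: "a \<in> ell1 H" "b \<in> ell1 H" "T a = T b"
    have "ell1_norm H (\<lambda>s. a s - b s) \<le> 0"
      using T_ge[OF ell1_diff[OF ab(1,2)]] diff[OF ab(1,2)] ab(3) by simp
    then have "a s = b s" if "s \<in> H" for s
      using ell1_abs_le_norm[OF ell1_diff[OF ab(1,2)], of "{s}"] that by simp
    then show "a = b"
      using ab(1,2) unfolding ell1_def by (intro ext) (metis (mono_tags, lifting) mem_Collect_eq)
  qed
  have "T a \<in> closure (span (f ` H))" if "a \<in> ell1 H" for a
  proof (rule Lim_in_closed_set)
    show "((\<lambda>F. \<Sum>s\<in>F. a s *\<^sub>R f s) \<longlongrightarrow> T a) (finite_subsets_at_top H)"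
      using sums[OF that] unfolding has_sum_def .
    show "\<forall>\<^sub>F F in finite_subsets_at_top H. (\<Sum>s\<in>F. a s *\<^sub>R f s) \<in> closure (span (f ` H))"
      by (intro eventually_finite_subsets_at_top_weakI closure_subset[THEN subsetD] span_sum span_scale span_base) auto
  qed auto
  moreover have "closure (span (f ` H)) \<subseteq> T ` ell1 H"
  proof (rule closure_minimal)
    have "subspace (T ` ell1 H)"
      unfolding subspace_def
    proof (intro conjI ballI allI)
      have "(\<lambda>_. 0) \<in> ell1 H" "T (\<lambda>_. 0) = 0" by (auto simp: ell1_def T_def)
      then show "0 \<in> T ` ell1 H" by (metis image_eqI)
      show "x + y \<in> T ` ell1 H" if "x \<in> T ` ell1 H" "y \<in> T ` ell1 H" for x y
        using that by (auto simp: add[symmetric] intro: ell1_add)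
      show "c *\<^sub>R x \<in> T ` ell1 H" if "x \<in> T ` ell1 H" for c x
        using that by (auto simp: scale[symmetric] intro: ell1_scale)
    qed
    moreover have "f ` H \<subseteq> T ` ell1 H"
      using delta by (metis image_eqI image_subsetI)
    ultimately show "span (f ` H) \<subseteq> T ` ell1 H" by (rule span_minimal[rotated])
    show "closed (T ` ell1 H)"
      unfolding closed_sequential_limits
    proof (intro allI impI, elim conjE)
      fix v x assume v: "\<forall>n. v n \<in> T ` ell1 H" and lim: "v \<longlonglongrightarrow> x"
      then have "\<forall>n. \<exists>a\<in>ell1 H. v n = T a" by blast
      then obtain a where a: "\<And>n. a n \<in> ell1 H" "\<And>n. v n = T (a n)" by metis
      have "\<exists>N. \<forall>m\<ge>N. \<forall>n\<ge>N. ell1_norm H (\<lambda>s. a m s - a n s) \<le> e" if "0 < e" for e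
      proof -
        obtain N where N: "\<forall>m\<ge>N. \<forall>n\<ge>N. norm (v m - v n) < e"
          using CauchyD[OF LIMSEQ_imp_Cauchy[OF lim] \<open>0 < e\<close>] by blast
        show ?thesis
        proof (intro exI allI impI)
          fix m n assume "N \<le> m" "N \<le> n"
          then have "norm (T (\<lambda>s. a m s - a n s)) < e"
            using N a by (simp add: diff)
          then show "ell1_norm H (\<lambda>s. a m s - a n s) \<le> e"
            using T_ge[OF ell1_diff[OF a(1) a(1)], of m n] by linarith
        qed
      qed
      then obtain l where l: "l \<in> ell1 H" "(\<lambda>n. ell1_norm H (\<lambda>s. a n s - l s)) \<longlonglongrightarrow> 0"
        using ell1_complete[of a H] a(1) by blast
      have "(\<lambda>n. v n - T l) \<longlonglongrightarrow> 0"
        using l(2)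
      proof (rule Lim_null_comparison[rotated])
        show "\<forall>\<^sub>F n in sequentially. norm (v n - T l) \<le> ell1_norm H (\<lambda>s. a n s - l s)"
          using T_le[OF ell1_diff[OF a(1) l(1)]] a l(1) by (simp add: diff)
      qed
      then have "v \<longlonglongrightarrow> T l" by (simp add: LIM_zero_iff)
      then show "x \<in> T ` ell1 H"
        using LIMSEQ_unique[OF lim] l(1) by blast
    qed
  qed
  ultimately have "bij_betw T (ell1 H) (closure (span (f ` H)))"
    unfolding bij_betw_def using inj by blast
  then have "ell1_isomorphism H (closure (span (f ` H))) T"
    unfolding ell1_isomorphism_def using add scale T_le T_ge
    by (intro conjI exI[of _ 1]) auto
  then show ?thesis using delta by blast
qed

text \<open>Independence gives a point at which the translates take the signs of given coefficients.
  Evaluation there bounds the norm of the linear combination below by the sum of the absolute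
  values.\<close>

lemma untame_of_infinite_shattered_set:
  fixes \<alpha> :: "'g \<Rightarrow> 'x::topological_space \<Rightarrow> 'x" and G :: "('g, 'm) monoid_scheme" (structure)
  assumes act: "continuous_action G \<alpha>" and "infinite H" "H \<subseteq> carrier G"
    and cont: "continuous_on UNIV (f :: 'x \<Rightarrow> real)" and f: "\<And>x. \<bar>f x\<bar> \<le> 1"
      "\<And>x. x \<in> B True \<Longrightarrow> f x = 1" "\<And>x. x \<in> B False \<Longrightarrow> f x = - 1"
    and shat: "\<And>J. finite J \<Longrightarrow> J \<subseteq> H \<Longrightarrow> shattered (\<lambda>s i. \<alpha> s -` B i) UNIV J"
  shows "untame G \<alpha>"
proof -
  interpret group_action G UNIV \<alpha> using act by (simp add: continuous_action_def)
  interpret group_hom G "BijGroup UNIV" \<alpha> by (rule group_hom)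
  define \<psi> where "\<psi> = Bcontfun f"
  have \<psi>: "apply_bcontfun \<psi> = f"
    unfolding \<psi>_def by (rule Bcontfun_inverse[OF bcontfun_normI[OF cont, of 1]]) (simp add: f)
  \<comment> \<open>\<^const>\<open>translate\<close> acts by the inverse.\<close>
  define H' where "H' = m_inv G ` H"
  have H': "H' \<subseteq> carrier G" using assms(3) by (auto simp: H'_def)
  have inv_H': "inv s \<in> H" if "s \<in> H'" for s
    using that assms(3) by (auto simp: H'_def subset_iff)
  have "inj_on (m_inv G) H"
    using assms(3) by (intro inj_onI) (metis G.inv_inv subsetD)
  then have inf: "infinite H'" unfolding H'_def using assms(2) by (simp add: finite_image_iff)
  have tr: "apply_bcontfun (translate G \<alpha> s \<psi>) x = f (\<alpha> (inv s) x)" if "s \<in> H'" for s x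
    using apply_translate[OF act, of s \<psi> x] that H' \<psi> by auto
  have "\<exists>T. ell1_isomorphism H' (closure (span ((\<lambda>s. translate G \<alpha> s \<psi>) ` H'))) T \<and>
      (\<forall>s\<in>H'. T (delta s) = translate G \<alpha> s \<psi>)"
  proof (rule ell1_isomorphism_if_lower_bound)
    show "norm (translate G \<alpha> s \<psi>) \<le> 1" if "s \<in> H'" for s
      by (rule norm_bound) (simp add: tr[OF that] f)
  next
    fix F and a :: "'g \<Rightarrow> real" assume F: "finite F" "F \<subseteq> H'"
    have *: "shattered (\<lambda>s i. \<alpha> s -` B i) UNIV (m_inv G ` F)"
      using F inv_H' by (intro shat) auto
    obtain x where x: "\<And>s. s \<in> m_inv G ` F \<Longrightarrow> \<alpha> s x \<in> B (0 \<le> a (inv s))"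
      using shatteredE[OF *, of "\<lambda>s. 0 \<le> a (inv s)"] by auto
    have "a s * f (\<alpha> (inv s) x) = \<bar>a s\<bar>" if "s \<in> F" for s
    proof -
      have "s \<in> carrier G" using that F H' by auto
      then have "\<alpha> (inv s) x \<in> B (0 \<le> a s)" using x[of "inv s"] that by simp
      then show ?thesis using f(2,3) by (cases "0 \<le> a s") auto
    qed
    then have "(\<Sum>s\<in>F. \<bar>a s\<bar>) = (\<Sum>s\<in>F. a s * f (\<alpha> (inv s) x))" by simp
    also have "\<dots> = (\<Sum>s\<in>F. apply_bcontfun (a s *\<^sub>R translate G \<alpha> s \<psi>) x)"
      using F(2) by (intro sum.cong) (auto simp: tr)
    also have "\<dots> = apply_bcontfun (\<Sum>s\<in>F. a s *\<^sub>R translate G \<alpha> s \<psi>) x"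
      using F(1) by (induction F rule: finite_induct) auto
    also have "\<dots> \<le> norm (apply_bcontfun (\<Sum>s\<in>F. a s *\<^sub>R translate G \<alpha> s \<psi>) x)" by simp
    also have "\<dots> \<le> norm (\<Sum>s\<in>F. a s *\<^sub>R translate G \<alpha> s \<psi>)" by (rule norm_bounded)
    finally show "(\<Sum>s\<in>F. \<bar>a s\<bar>) \<le> norm (\<Sum>s\<in>F. a s *\<^sub>R translate G \<alpha> s \<psi>)" .
  qed
  then show ?thesis unfolding untame_def using H' inf by blast
qed

section \<open>Vanishing of the naive entropy of tame actions\<close>

lemma naive_entropy_nonneg: "0 \<le> naive_entropy G \<alpha>"
proof -
  \<comment> \<open>The case \<open>n = 0\<close> rests on the default value
    \<open>ln 0 = 0\<close>.\<close>
  have ln: "0 \<le> ln (real n)" for n :: nat by (cases n) auto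
  have "0 \<le> naive_entropy_cover G \<alpha> {UNIV}"
    unfolding naive_entropy_cover_def
    by (rule INF_greatest) (simp add: ln zero_ereal_def[symmetric])
  also have "\<dots> \<le> naive_entropy G \<alpha>"
    unfolding naive_entropy_def by (rule SUP_upper) (simp add: finite_open_cover_def)
  finally show ?thesis .
qed

theorem theorem1p3:
  fixes G :: "('g, 'm) monoid_scheme"
    and \<alpha> :: "'g \<Rightarrow> 'x::topological_space \<Rightarrow> 'x"
  assumes "group G" and "countable (carrier G)" and "infinite (carrier G)"
    and "compact (UNIV :: 'x set)"
    and "metrizable_space (euclidean :: 'x topology)"
    and "continuous_action G \<alpha>"
    and "tame G \<alpha>"
  shows "naive_entropy G \<alpha> = 0"
proof (rule antisym[OF _ naive_entropy_nonneg], unfold naive_entropy_def, rule SUP_least, rule ccontr)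
  interpret group_action G UNIV \<alpha> using assms(6) by (simp add: continuous_action_def)
  fix \<U> assume "\<U> \<in> {\<U>. finite_open_cover \<U>}" and pos: "\<not> naive_entropy_cover G \<alpha> \<U> \<le> 0"
  then have \<U>: "finite \<U>" "\<And>U. U \<in> \<U> \<Longrightarrow> open U" "\<Union>\<U> = UNIV"
    by (auto simp: finite_open_cover_def)
  have normal: "normal_space (euclidean :: 'x topology)"
    using assms(5) by (rule metrizable_imp_normal_space)
  obtain D :: "'x set \<Rightarrow> 'x set" where D: "\<And>U. U \<in> \<U> \<Longrightarrow> closed (D U) \<and> D U \<subseteq> U" "(\<Union>U\<in>\<U>. D U) = UNIV"
    using closed_shrinking[OF normal \<U>(1,2), of UNIV] \<U>(3) by auto
  obtain r where r: "0 < ereal r" "ereal r < naive_entropy_cover G \<alpha> \<U>"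
    using pos ereal_dense2[of 0 "naive_entropy_cover G \<alpha> \<U>"] by (auto simp: not_le)
  then have "0 < r" by simp
  have large: "exp (r * real (card F)) \<le> real (cover_number (join_translates G \<alpha> \<U> F))"
    if F: "F \<subseteq> carrier G" "finite F" "F \<noteq> {}" for F
  proof -
    let ?N = "real (cover_number (join_translates G \<alpha> \<U> F))"
    have "card F > 0" using F by (simp add: card_gt_0_iff)
    have "ereal r \<le> ereal (1 / real (card F) * ln ?N)"
      using r(2) F unfolding naive_entropy_cover_def
      by (intro order_trans[OF less_imp_le[OF r(2)[unfolded naive_entropy_cover_def]]] INF_lower) simp
    then have "r * real (card F) \<le> ln ?N"
      using \<open>card F > 0\<close> by (simp add: field_simps)
    \<comment> \<open>A positive logarithm rules out the default value \<open>ln 0 = 0\<close>, so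
      the inequality can be exponentiated.\<close>
    moreover have "0 < r * real (card F)" using \<open>0 < r\<close> \<open>card F > 0\<close> by simp
    ultimately have "0 < ln ?N" by linarith
    then have "?N > 0" by (cases "cover_number (join_translates G \<alpha> \<U> F)") auto
    with \<open>r * real (card F) \<le> ln ?N\<close> show ?thesis by (simp add: ln_ge_iff)
  qed
  obtain H U where H: "infinite H" "H \<subseteq> carrier G" and U: "U \<in> \<U>"
    and shat: "\<And>J. finite J \<Longrightarrow> J \<subseteq> H \<Longrightarrow> shattered (\<lambda>s i. \<alpha> s -` (if i then D U else - U)) UNIV J"
    using infinite_shattered_set[OF refl assms(3) \<U>(1) D(2) conjunct2[OF D(1)] \<open>0 < r\<close> large] by blast
  \<comment> \<open>Shrinking the cover has made \<open>D U\<close> and \<open>- U\<close> disjoint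
    closed sets, so a continuous function can take the values 1 and -1 on them.\<close>
  obtain f :: "'x \<Rightarrow> real" where f: "continuous_map euclidean (top_of_set {-1..1}) f"
      "f ` (- U) \<subseteq> {-1}" "f ` D U \<subseteq> {1}"
    using Urysohn_lemma[OF normal, of "- U" "D U" "-1" 1] D(1)[OF U] \<U>(2)[OF U]
    by (auto simp: disjnt_def closed_Compl open_closed)
  have "untame G \<alpha>"
  proof (rule untame_of_infinite_shattered_set[OF assms(6) H, where f = f and B = "\<lambda>i. if i then D U else - U"])
    show "continuous_on UNIV f" "\<bar>f x\<bar> \<le> 1" for x
      using f(1) by (auto simp: continuous_map_in_subtopology abs_le_iff)
  qed (use f shat in auto)
  then show False using assms(7) by (simp add: tame_def)
qed

end
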